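(* For every graph $G$ the following are equivalent: (i) every induced subgraph $H$ of $G$ satisfies $\tau_c(H) \leq \frac{3}{2}\,\tau(H)$; (ii) $G$ contains none of $P_7$, $C_6$, $\Delta_1$, $\Delta_2$ as an induced subgraph.
   Context: All graphs are finite and simple. A vertex cover of $G$ is a set $C \subseteq V(G)$ meeting every edge; $\tau(G)$ is the minimum size of a vertex cover. A connected vertex cover of $G$ is a vertex cover $C$ such that $G[C]$ is connected (if $G$ is disconnected, $G[C]$ must have the same number of connected components as $G$); $\tau_c(G)$ is its minimum size. $P_k$ denotes the path on $k$ vertices and $C_k$ the cycle on $k$ vertices. $\Delta_1$ is the 7-vertex graph consisting of two 4-cycles sharing exactly one vertex (so that this vertex has degree 4); explicitly, vertices $c,a_1,a_2,a_3,b_1,b_2,b_3$ and edges $ca_1,a_1a_2,a_2a_3,a_3c,cb_1,b_1b_2,b_2b_3,b_3c$. $\Delta_2$ is obtained from $\Delta_1$ by deleting one edge incident to the degree-4 vertex (e.g. the edge $ca_1$).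
   Formalization: In the definition of a connected vertex cover, isolated vertices are not counted among the connected components of the graph; counting them makes the claim false (two isolated vertices have vertex cover number 0 but connected vertex cover number 2). *)

theory Defs
  imports "Graph_Theory.Graph_Theory"
begin

(* A finite simple graph is a digraph satisfying the library predicate graph: finite, symmetric,
   without loops and parallel arcs, each edge being a pair of opposite arcs.  By symmetry the
   strongly connected components (sccs) are the connected components. *)

definition vertex_cover :: "('a, 'b) pre_digraph \<Rightarrow> 'a set \<Rightarrow> bool" where
  "vertex_cover G C \<longleftrightarrow> C \<subseteq> verts G \<and> (\<forall>e \<in> arcs G. tail G e \<in> C \<or> head G e \<in> C)"

definition vc_number :: "('a, 'b) pre_digraph \<Rightarrow> nat" where
  "vc_number G = (LEAST k. \<exists>C. vertex_cover G C \<and> card C = k)"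

(* Isolated vertices of G are not counted as components: they carry no edge to be covered, and
   counting them would force a cover of G to contain all of them, so that already a graph with
   two vertices and no edge would have vertex cover number 0 but connected number 2.
   For graphs without isolated vertices the count is the plain number of components, and for a
   connected G with an edge the condition says that the subgraph induced by C is connected; see
   the two lemmas below. *)
definition connected_vertex_cover :: "('a, 'b) pre_digraph \<Rightarrow> 'a set \<Rightarrow> bool" where
  "connected_vertex_cover G C \<longleftrightarrow> vertex_cover G C \<and>
     card (pre_digraph.sccs (G \<restriction> C)) = card {K \<in> pre_digraph.sccs G. arcs K \<noteq> {}}"

definition cvc_number :: "('a, 'b) pre_digraph \<Rightarrow> nat" where
  "cvc_number G = (LEAST k. \<exists>C. connected_vertex_cover G C \<and> card C = k)"

definition contains_induced :: "('a, 'b) pre_digraph \<Rightarrow> ('c, 'd) pre_digraph \<Rightarrow> bool" where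
  "contains_induced G P \<longleftrightarrow> (\<exists>H. induced_subgraph H G \<and> digraph_iso H P)"

definition graph_of :: "nat \<Rightarrow> nat rel \<Rightarrow> nat pair_pre_digraph" where
  "graph_of n E = \<lparr> pverts = {..<n}, parcs = E \<union> E\<inverse> \<rparr>"

definition path_graph :: "nat \<Rightarrow> nat pair_pre_digraph" where
  "path_graph k = graph_of k {(i, Suc i) | i. Suc i < k}"

(* intended for k at least 3 *)
definition cycle_graph :: "nat \<Rightarrow> nat pair_pre_digraph" where
  "cycle_graph k = graph_of k {(i, Suc i mod k) | i. i < k}"

(* vertex 0 is c, vertices 1, 2, 3 are a1, a2, a3 and vertices 4, 5, 6 are b1, b2, b3 *)
definition Delta1 :: "nat pair_pre_digraph" where
  "Delta1 = graph_of 7 {(0,1), (1,2), (2,3), (3,0), (0,4), (4,5), (5,6), (6,0)}"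

definition Delta2 :: "nat pair_pre_digraph" where
  "Delta2 = Delta1 \<lparr> parcs := parcs Delta1 - {(0,1), (1,0)} \<rparr>"

lemma (in sym_digraph) connected_iff_card_sccs: "connected G \<longleftrightarrow> card sccs = 1"
proof -
  have sym: "(arcs_ends G)\<^sup>s = arcs_ends G"
    using sym_arcs by (auto simp: symmetric_def symcl_def sym_def)
  have "connected G \<longleftrightarrow> strongly_connected G"
    unfolding connected_conv strongly_connected_def reachable_def sym ..
  also have "\<dots> \<longleftrightarrow> card sccs = 1"
  proof
    assume "card sccs = 1"
    then obtain K where K: "sccs = {K}" by (auto simp: card_1_singleton_iff)
    then have ind: "induced_subgraph K G" by (auto simp: sccs_def)
    have "verts K = verts G"
    proof
      show "verts G \<subseteq> verts K" using scc_for_vert_ex K by auto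
      show "verts K \<subseteq> verts G" using ind by (auto simp: induced_subgraph_def subgraph_def)
    qed
    then have "K = G" using ind induced_subgraph_refl by (blast intro: induced_eq_verts_imp_eq)
    then show "strongly_connected G" using K strongly_connected_eq_iff by simp
  qed (simp add: strongly_connected_eq_iff)
  finally show ?thesis .
qed

lemma sym_digraph_induce:
  assumes "graph G" "C \<subseteq> verts G"
  shows "sym_digraph (G \<restriction> C)"
proof -
  interpret graph G by fact
  have ind: "induced_subgraph (G \<restriction> C) G" using assms(2) by (rule induced_induce)
  interpret C: wf_digraph "G \<restriction> C" using ind by (rule wf_digraphI_induced)
  show ?thesis using induced_graph_imp_symmetric[OF sym_arcs ind] by unfold_locales
qed

lemma connected_vertex_cover_connected_iff:
  assumes "graph G" "connected G" "arcs G \<noteq> {}"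
  shows "connected_vertex_cover G C \<longleftrightarrow> vertex_cover G C \<and> connected (G \<restriction> C)"
proof (cases "vertex_cover G C")
  case True
  interpret graph G by fact
  from True have "C \<subseteq> verts G" by (simp add: vertex_cover_def)
  then interpret C: sym_digraph "G \<restriction> C" using assms(1) by (intro sym_digraph_induce)
  have "sccs = {G}"
    using assms(2) sym_arcs symmetric_connected_imp_strongly_connected strongly_connected_eq_iff
    by simp
  then have "{K \<in> sccs. arcs K \<noteq> {}} = {G}" using assms(3) by auto
  then have "card {K \<in> sccs. arcs K \<noteq> {}} = 1" by simp
  then show ?thesis using True C.connected_iff_card_sccs by (simp add: connected_vertex_cover_def)
qed (simp add: connected_vertex_cover_def)

lemma connected_vertex_cover_no_isolated_iff:
  assumes "graph G" and no_isolated: "\<forall>v \<in> verts G. \<exists>e \<in> arcs G. tail G e = v"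
  shows "connected_vertex_cover G C \<longleftrightarrow> vertex_cover G C \<and>
     card (pre_digraph.sccs (G \<restriction> C)) = card (pre_digraph.sccs G)"
proof -
  interpret graph G by fact
  have "arcs K \<noteq> {}" if K: "K \<in> sccs" for K
  proof -
    from K have ind: "induced_subgraph K G" and "verts K \<noteq> {}"
      by (auto simp: sccs_def strongly_connected_def)
    then obtain v where v: "v \<in> verts K" "v \<in> verts G"
      by (auto simp: induced_subgraph_def subgraph_def)
    with no_isolated obtain e where e: "e \<in> arcs G" "tail G e = v" by blast
    have "e \<in> \<Union> (arcs ` sccs)"
      using e(1) graph_is_union_sccs by (metis Union_def pre_digraph.select_convs(2))
    then obtain L where L: "L \<in> sccs" "e \<in> arcs L" by blast
    then have "v \<in> verts L"
      using e(2) by (auto simp: sccs_def induced_subgraph_def)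
    then have "L = K" using v L(1) K scc_disj by blast
    then show ?thesis using L by auto
  qed
  then have "{K \<in> sccs. arcs K \<noteq> {}} = sccs" by blast
  then show ?thesis by (simp add: connected_vertex_cover_def)
qed

lemma pair_graph_graph_of:
  assumes "E \<subseteq> {..<n} \<times> {..<n}" "irrefl E"
  shows "pair_graph (graph_of n E)"
proof -
  have "finite E" using assms(1) by (rule finite_subset) simp
  then show ?thesis
    using assms
    by unfold_locales
      (auto simp: graph_of_def irrefl_def symmetric_def sym_def)
qed

lemma pair_graph_patterns:
  "pair_graph (path_graph k)"
  "2 \<le> k \<Longrightarrow> pair_graph (cycle_graph k)"
  "pair_graph Delta1"
  "pair_graph Delta2"
proof -
  show "pair_graph (path_graph k)"
    unfolding path_graph_def by (rule pair_graph_graph_of) (auto simp: irrefl_def)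
  show "pair_graph (cycle_graph k)" if "2 \<le> k"
    unfolding cycle_graph_def using that
    by (intro pair_graph_graph_of) (auto simp: irrefl_def mod_Suc intro!: gr0I)
  show "pair_graph Delta1"
    unfolding Delta1_def by (rule pair_graph_graph_of) (auto simp: irrefl_def)
  have Delta2: "Delta2 = graph_of 7 {(1,2), (2,3), (3,0), (0,4), (4,5), (5,6), (6,0)}"
    by (auto simp: Delta2_def Delta1_def graph_of_def)
  show "pair_graph Delta2"
    unfolding Delta2 by (rule pair_graph_graph_of) (auto simp: irrefl_def)
qed

end

theory Submission
  imports Defs
begin

text \<open>Each of the four patterns has vertex cover number at most 3, while cut arguments force a
  connected vertex cover of it to have at least 5 vertices. Conversely, in a connected graph without
  the patterns, take a minimum vertex cover \<open>C\<close> that induces as few isolated vertices as possible;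
  every such isolated vertex then has at least two neighbours. Two isolated vertices are at distance
  2 or 5. Being at distance 2 is an equivalence, and any three members of a class have a common
  neighbour. Vertices of different classes are joined by walks \<open>x - p - c - d - q - z\<close> with
  \<open>c, d \<in> C\<close>, where \<open>N(x) \<subseteq> N(c)\<close> and \<open>N(z) \<subseteq> N(d)\<close>, and all these \<open>c, d\<close> lie in one component
  of \<open>C\<close>, which thus has at least as many vertices as there are classes. Counting then shows that
  \<open>card C div 2\<close> further vertices suffice to connect \<open>C\<close>.\<close>

section \<open>Connecting a set of vertices\<close>

text \<open>The budget is half a new vertex for each vertex of \<open>C\<close>. Components of
  \<open>C\<close> with at least two vertices keep within it: the complement of \<open>C\<close> is
  independent, so one new vertex per component is enough to merge them. Only isolated vertices break
  the budget, since each may spend just half a connector. A connector therefore has to serve two of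
  them and also touch a fixed root, which is why three members of a class need a common neighbour. A
  class of odd size still overspends by one half, and with many classes this adds up. The inclusions
  \<open>N(x) \<subseteq> N(c)\<close> repair it: each class can be rooted at a vertex of the cover
  instead of at its own member, different classes get different roots, and all these roots lie in
  one component. That component needs no connection of its own, so the half vertices it saves cover
  the excess. The second neighbour of an isolated vertex is what prolongs a walk to seven vertices
  or closes a 4-cycle, so isolated vertices of degree 1 have to be exchanged away
  beforehand.\<close>

definition reach :: "('a \<Rightarrow> 'a \<Rightarrow> bool) \<Rightarrow> 'a set \<Rightarrow> 'a \<Rightarrow> 'a \<Rightarrow> bool" where
  "reach E S = (\<lambda>u v. u \<in> S \<and> v \<in> S \<and> E u v)\<^sup>*\<^sup>*"

lemma reach_refl [simp]: "reach E S u u"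
  by (simp add: reach_def)

lemma reach_trans: "reach E S u v \<Longrightarrow> reach E S v w \<Longrightarrow> reach E S u w"
  unfolding reach_def by (rule rtranclp_trans)

lemma reach_edge: "u \<in> S \<Longrightarrow> v \<in> S \<Longrightarrow> E u v \<Longrightarrow> reach E S u v"
  unfolding reach_def by blast

lemma reach_mono: "reach E S u v \<Longrightarrow> S \<subseteq> T \<Longrightarrow> reach E T u v"
  unfolding reach_def by (erule rtranclp_mono[THEN predicate2D, rotated]) auto

lemma reach_sym:
  assumes "symp E" "reach E S u v"
  shows "reach E S v u"
proof -
  have "symp (\<lambda>u v. u \<in> S \<and> v \<in> S \<and> E u v)"
    using assms(1) by (auto simp: symp_def)
  then show ?thesis
    using assms(2) unfolding reach_def by (metis sympD symp_rtranclp)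
qed

lemma reach_closed:
  assumes "reach E S u v" "u \<in> A" "\<And>a b. a \<in> A \<Longrightarrow> a \<in> S \<Longrightarrow> b \<in> S \<Longrightarrow> E a b \<Longrightarrow> b \<in> A"
  shows "v \<in> A"
  using assms(1) unfolding reach_def
  by (induction rule: rtranclp_induct) (use assms in auto)

text \<open>Without isolated vertices every component has at least two vertices, so one root per
  component takes at most half. Removing a whole component preserves the hypothesis, because the
  neighbours of a remaining vertex remain.\<close>

lemma half_anchors:
  assumes "finite U" "symp E" "irreflp E" "\<And>u. u \<in> U \<Longrightarrow> \<exists>v\<in>U. E u v"
  shows "\<exists>R\<subseteq>U. 2 * card R \<le> card U \<and> (\<forall>u\<in>U. \<exists>r\<in>R. reach E U r u)"
  using assms
proof (induction "card U" arbitrary: U rule: less_induct)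
  case less
  show ?case
  proof (cases "U = {}")
    case False
    then obtain u where u: "u \<in> U" by blast
    then obtain v where v: "v \<in> U" "E u v" using less.prems by blast
    define K where "K = {w \<in> U. reach E U u w}"
    have K: "{u, v} \<subseteq> K" using u v by (auto simp: K_def intro: reach_edge)
    have "u \<noteq> v" using v less.prems by (auto simp: irreflp_def)
    have "K \<subseteq> U" by (auto simp: K_def)
    then have fK: "finite K" using less.prems(1) finite_subset by blast
    have cK: "2 \<le> card K" using card_mono[OF fK K] \<open>u \<noteq> v\<close> by simp
    have cU: "card (U - K) = card U - card K" "card K \<le> card U"
      using \<open>K \<subseteq> U\<close> fK less.prems(1) by (auto intro: card_Diff_subset card_mono)
    have "\<exists>R\<subseteq>U - K. 2 * card R \<le> card (U - K) \<and> (\<forall>u\<in>U - K. \<exists>r\<in>R. reach E (U - K) r u)"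
    proof (rule less.hyps)
      show "card (U - K) < card U" using cK cU by linarith
      show "finite (U - K)" using less.prems by simp
      fix w assume w: "w \<in> U - K"
      then obtain w' where w': "w' \<in> U" "E w w'" using less.prems by blast
      then have "w' \<notin> K"
        using w less.prems(2)
        by (auto simp: K_def dest: reach_trans[OF _ reach_edge[of w' U w]] sympD)
      then show "\<exists>v\<in>U - K. E w v" using w' by blast
    qed (use less.prems in auto)
    then obtain R where R: "R \<subseteq> U - K" "2 * card R \<le> card (U - K)"
      "\<And>w. w \<in> U - K \<Longrightarrow> \<exists>r\<in>R. reach E (U - K) r w" by metis
    have fR: "finite R" using R(1) less.prems(1) by (meson finite_Diff finite_subset)
    show ?thesis
    proof (intro exI[of _ "insert u R"] conjI ballI)
      show "insert u R \<subseteq> U" using R u by blast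
      have "card (insert u R) \<le> Suc (card R)" using fR by (simp add: card_insert_if)
      then show "2 * card (insert u R) \<le> card U" using R(2) cK cU by linarith
      fix w assume w: "w \<in> U"
      show "\<exists>r\<in>insert u R. reach E U r w"
      proof (cases "w \<in> K")
        case True then show ?thesis by (auto simp: K_def)
      next
        case False
        then show ?thesis using R(3)[of w] w by (auto intro: reach_mono)
      qed
    qed
  qed auto
qed

text \<open>The vertices of \<open>A\<close> are used up two at a time, each pair paid with one
  connector that also touches the root \<open>r\<close>. The hypothesis includes
  \<open>y = y'\<close>, which serves an odd vertex at the end and causes the
  \<open>+ 1\<close>.\<close>

lemma attach_pairs:
  assumes "finite A" "symp E"
    and "\<And>y y'. y \<in> A \<Longrightarrow> y' \<in> A \<Longrightarrow> \<exists>w. E w y \<and> E w y' \<and> E w r"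
  shows "\<exists>J. finite J \<and> 2 * card J \<le> card A + 1 \<and> (\<forall>w\<in>J. E w r)
    \<and> (\<forall>y\<in>A. reach E (insert r (A \<union> J)) r y)"
  using assms
proof (induction "card A" arbitrary: A rule: less_induct)
  case less
  show ?case
  proof (cases "A = {}")
    case True
    then show ?thesis by (intro exI[of _ "{}"]) auto
  next
    case False
    then obtain y where y: "y \<in> A" by blast
    obtain y' where y': "y' \<in> A" "A = {y} \<or> y' \<noteq> y" using y by blast
    obtain w where w: "E w y" "E w y'" "E w r" using less.prems(3) y y' by blast
    let ?B = "A - {y, y'}"
    have "card ?B < card A" using less.prems(1) y by (intro psubset_card_mono) auto
    then obtain J where J: "finite J" "2 * card J \<le> card ?B + 1" "\<forall>w\<in>J. E w r"
      "\<forall>y\<in>?B. reach E (insert r (?B \<union> J)) r y"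
      using less.hyps[of ?B] less.prems by blast
    have 1: "2 * card (insert w J) \<le> card A + 1"
    proof (cases "A = {y}")
      case True
      then have "card ?B = 0" by auto
      then have "card J = 0" using J(2) by linarith
      then show ?thesis using J(1) True by (simp add: card_insert_if)
    next
      case False
      then have "card {y, y'} = 2" using y' by auto
      moreover have "{y, y'} \<subseteq> A" using y y' by auto
      ultimately have "card ?B = card A - 2" "2 \<le> card A"
        using less.prems(1) by (metis card_Diff_subset finite.emptyI finite.insertI, metis card_mono)
      moreover have "card (insert w J) \<le> Suc (card J)" using J(1) by (simp add: card_insert_if)
      ultimately show ?thesis using J(2) by linarith
    qed
    have E: "E r w" "E w y" "E w y'" using w less.prems(2) by (auto dest: sympD)
    show ?thesis
    proof (intro exI[of _ "insert w J"] conjI ballI)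
      fix z assume z: "z \<in> A"
      let ?S = "insert r (A \<union> insert w J)"
      have rw: "reach E ?S r w" using E by (intro reach_edge) auto
      show "reach E ?S r z"
      proof (cases "z \<in> ?B")
        case True
        then have "reach E (insert r (?B \<union> J)) r z" using J by blast
        then show ?thesis by (rule reach_mono) auto
      next
        case False
        then have "z = y \<or> z = y'" using z by blast
        then have "reach E ?S w z" using E y y' by (intro reach_edge) auto
        with rw show ?thesis by (rule reach_trans)
      qed
    qed (use J w 1 in auto)
  qed
qed

section \<open>Merging the components of a set that contains a vertex cover\<close>

locale connected_graph =
  fixes V :: "'a set" and E :: "'a \<Rightarrow> 'a \<Rightarrow> bool"
  assumes fin: "finite V"
    and edge_in: "E u v \<Longrightarrow> u \<in> V"
    and sym: "E u v \<Longrightarrow> E v u"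
    and irr: "\<not> E u u"
    and conn: "u \<in> V \<Longrightarrow> v \<in> V \<Longrightarrow> E\<^sup>*\<^sup>* u v"
begin

lemma symp_E: "symp E"
  using sym by (auto simp: symp_def)

lemma irreflp_E: "irreflp E"
  using irr by (auto simp: irreflp_def)

lemma closed_eq_V:
  assumes "u \<in> A" "u \<in> V" "\<And>a b. a \<in> A \<Longrightarrow> E a b \<Longrightarrow> b \<in> A"
  shows "V \<subseteq> A"
proof
  fix v assume "v \<in> V"
  with assms(2) have "E\<^sup>*\<^sup>* u v" by (rule conn)
  then show "v \<in> A" by (induction rule: rtranclp_induct) (use assms in auto)
qed

lemma connect_anchored:
  assumes cover: "\<And>u v. E u v \<Longrightarrow> u \<in> C \<or> v \<in> C"
    and "C \<subseteq> S" "S \<subseteq> V" "R \<subseteq> S" "R \<noteq> {}" "\<And>s. s \<in> S \<Longrightarrow> \<exists>r\<in>R. reach E S r s"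
  shows "\<exists>S'. S \<subseteq> S' \<and> S' \<subseteq> V \<and> card S' + 1 \<le> card S + card R
    \<and> (\<forall>u\<in>S'. \<forall>v\<in>S'. reach E S' u v)"
  using assms(2-)
proof (induction "card R" arbitrary: S R)
  case 0
  have "finite R" using 0 fin by (meson finite_subset)
  with 0 show ?case by simp
next
  case (Suc n)
  have fS: "finite S" using Suc.prems fin by (meson finite_subset)
  then have fR: "finite R" using Suc.prems by (meson finite_subset)
  obtain r where r: "r \<in> R" using Suc.prems by blast
  show ?case
  proof (cases "\<forall>s\<in>S. reach E S r s")
    case True
    have "\<forall>u\<in>S. \<forall>v\<in>S. reach E S u v"
      using True reach_sym[OF symp_E] reach_trans by metis
    moreover have "card R \<ge> 1" using Suc by linarith
    ultimately show ?thesis using Suc.prems by (intro exI[of _ S]) auto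
  next
    case False
    define X where "X = {s\<in>S. reach E S r s}"
    obtain y where y: "y \<in> S" "y \<notin> X" using False by (auto simp: X_def)
    have rX: "r \<in> X" using r Suc.prems by (auto simp: X_def)
    have Xcl: "b \<in> X" if "a \<in> X" "b \<in> S" "E a b" for a b
      using that by (auto simp: X_def intro: reach_trans[OF _ reach_edge])
    have "\<exists>w u u'. w \<notin> S \<and> u \<in> X \<and> u' \<in> S - X \<and> E u w \<and> E w u'"
    proof (rule ccontr)
      assume neg: "\<not> ?thesis"
      \<comment> \<open>A vertex outside \<open>S\<close> has all its neighbours in
        \<open>C\<close>, hence in \<open>S\<close>. Without a bridge those of an outer neighbour of
        \<open>X\<close> lie in \<open>X\<close>, so \<open>X\<close> with its outer neighbours is
        closed under adjacency.\<close>
      have "V \<subseteq> X \<union> {w. w \<notin> S \<and> (\<exists>u\<in>X. E u w)}"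
      proof (rule closed_eq_V)
        show "r \<in> V" using r Suc.prems by blast
        show "r \<in> X \<union> {w. w \<notin> S \<and> (\<exists>u\<in>X. E u w)}" using rX by blast
        fix a b assume a: "a \<in> X \<union> {w. w \<notin> S \<and> (\<exists>u\<in>X. E u w)}" and ab: "E a b"
        show "b \<in> X \<union> {w. w \<notin> S \<and> (\<exists>u\<in>X. E u w)}"
        proof (cases "a \<in> X")
          case True then show ?thesis using Xcl ab by blast
        next
          case False
          then obtain u where u: "a \<notin> S" "u \<in> X" "E u a" using a by blast
          then have "b \<in> S" using cover ab Suc.prems(1) by blast
          then have "b \<in> X" using neg u ab by blast
          then show ?thesis by blast
        qed
      qed
      then show False using y Suc.prems by blast
    qed
    then obtain w u u' where w: "w \<notin> S" "u \<in> X" "u' \<in> S" "u' \<notin> X" "E u w" "E w u'" by blast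
    obtain r' where r': "r' \<in> R" "reach E S r' u'" using Suc.prems(5) w by blast
    then have "r' \<noteq> r" using w by (auto simp: X_def)
    let ?S = "insert w S" and ?R = "R - {r}"
    have r'u': "reach E ?S r' u'" using r' by (auto intro: reach_mono)
    have wV: "w \<in> V" using w edge_in by blast
    have r'w: "reach E ?S r' w"
      using r'u' reach_edge[of u' ?S w E] w sym by (auto intro: reach_trans)
    have r'u: "reach E ?S r' u"
      using r'w reach_edge[of w ?S u E] w sym by (auto simp: X_def intro: reach_trans)
    have r'r: "reach E ?S r' r"
    proof -
      have "reach E ?S r u" using w by (auto simp: X_def intro: reach_mono)
      then show ?thesis using r'u reach_sym[OF symp_E] reach_trans by metis
    qed
    have "\<exists>S'. ?S \<subseteq> S' \<and> S' \<subseteq> V \<and> card S' + 1 \<le> card ?S + card ?R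
      \<and> (\<forall>u\<in>S'. \<forall>v\<in>S'. reach E S' u v)"
    proof (rule Suc.hyps(1))
      show "n = card ?R" using Suc.hyps(2) fR r by simp
      show "?R \<noteq> {}" using r' \<open>r' \<noteq> r\<close> by blast
      fix s assume "s \<in> ?S"
      then consider "s = w" | "s \<in> S" by blast
      then show "\<exists>r\<in>?R. reach E ?S r s"
      proof cases
        case 1 then show ?thesis using r'w r' \<open>r' \<noteq> r\<close> by blast
      next
        case 2
        then obtain q where q: "q \<in> R" "reach E S q s" using Suc.prems by blast
        then have q': "reach E ?S q s" by (auto intro: reach_mono)
        show ?thesis
        proof (cases "q = r")
          case True
          then show ?thesis using r'r q' r' \<open>r' \<noteq> r\<close> by (auto intro: reach_trans)
        next
          case False then show ?thesis using q q' by blast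
        qed
      qed
    qed (use Suc.prems wV in auto)
    then obtain S' where S': "?S \<subseteq> S'" "S' \<subseteq> V" "card S' + 1 \<le> card ?S + card ?R"
      "\<forall>u\<in>S'. \<forall>v\<in>S'. reach E S' u v" by blast
    have "card ?R + 1 = card R" using fR r by (metis card_Suc_Diff1 Suc_eq_plus1)
    moreover have "card ?S = card S + 1" using fS w by simp
    ultimately show ?thesis using S' by (intro exI[of _ S']) auto
  qed
qed

end

section \<open>Covers of connected graphs without the four patterns\<close>

text \<open>Each assumption excludes an explicit induced copy. In \<open>P7\<close> and
  \<open>C6\<close> distinct vertices have distinct neighbourhoods, so adjacency alone separates
  them. The only twins are \<open>a1\<close>, \<open>a3\<close> and \<open>b1\<close>,
  \<open>b3\<close> in \<open>D1\<close> and \<open>b1\<close>, \<open>b3\<close> in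
  \<open>D2\<close>; these are required to differ.\<close>

locale pattern_free_graph = connected_graph +
  assumes P7: "\<lbrakk>E v0 v1; E v1 v2; E v2 v3; E v3 v4; E v4 v5; E v5 v6;
      \<not> E v0 v2; \<not> E v0 v3; \<not> E v0 v4; \<not> E v0 v5; \<not> E v0 v6;
      \<not> E v1 v3; \<not> E v1 v4; \<not> E v1 v5; \<not> E v1 v6;
      \<not> E v2 v4; \<not> E v2 v5; \<not> E v2 v6;
      \<not> E v3 v5; \<not> E v3 v6; \<not> E v4 v6\<rbrakk> \<Longrightarrow> False"
    and C6: "\<lbrakk>E v0 v1; E v1 v2; E v2 v3; E v3 v4; E v4 v5; E v5 v0;
      \<not> E v0 v2; \<not> E v0 v3; \<not> E v0 v4; \<not> E v1 v3; \<not> E v1 v4; \<not> E v1 v5;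
      \<not> E v2 v4; \<not> E v2 v5; \<not> E v3 v5\<rbrakk> \<Longrightarrow> False"
    and D1: "\<lbrakk>a1 \<noteq> a3; b1 \<noteq> b3; E c a1; E a1 a2; E a2 a3; E a3 c; E c b1; E b1 b2; E b2 b3; E b3 c;
      \<not> E c a2; \<not> E c b2; \<not> E a1 a3; \<not> E b1 b3;
      \<not> E a1 b1; \<not> E a1 b2; \<not> E a1 b3; \<not> E a2 b1; \<not> E a2 b2; \<not> E a2 b3;
      \<not> E a3 b1; \<not> E a3 b2; \<not> E a3 b3\<rbrakk> \<Longrightarrow> False"
    and D2: "\<lbrakk>b1 \<noteq> b3; E a1 a2; E a2 a3; E a3 c; E c b1; E b1 b2; E b2 b3; E b3 c;
      \<not> E c a1; \<not> E c a2; \<not> E c b2; \<not> E a1 a3; \<not> E b1 b3;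
      \<not> E a1 b1; \<not> E a1 b2; \<not> E a1 b3; \<not> E a2 b1; \<not> E a2 b2; \<not> E a2 b3;
      \<not> E a3 b1; \<not> E a3 b2; \<not> E a3 b3\<rbrakk> \<Longrightarrow> False"
begin

text \<open>A shortest path is induced, and with six edges it would be a \<open>P7\<close>.\<close>

lemma short_walk:
  assumes "x \<in> V" "z \<in> V"
  shows "\<exists>n\<le>5. (E ^^ n) x z"
proof (rule ccontr)
  assume neg: "\<not> ?thesis"
  define d where "d v = (LEAST n. (E ^^ n) x v)" for v
  have walk: "(E ^^ d v) x v" if "v \<in> V" for v
  proof -
    have "\<exists>n. (E ^^ n) x v" using conn[OF assms(1) that] by (simp add: rtranclp_power)
    then show ?thesis unfolding d_def by (rule LeastI_ex)
  qed
  have le: "d v \<le> n" if "(E ^^ n) x v" for v n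
    unfolding d_def using that by (rule Least_le)
  have step: "d v \<le> Suc (d u)" if "E u v" for u v
    using walk[OF edge_in[OF that]] that by (intro le) auto
  have nonadj: "\<not> E u v" if "Suc (d u) < d v" for u v
    using step[of u v] that by linarith
  have pred: "\<exists>u. E u v \<and> d u = n" if "d v = Suc n" "v \<in> V" for v n
  proof -
    have "(E ^^ Suc n) x v" using walk[OF that(2)] that(1) by simp
    then obtain u where u: "(E ^^ n) x u" "E u v" by auto
    have "d u = n" using le[OF u(1)] step[OF u(2)] that(1) by linarith
    then show ?thesis using u by blast
  qed
  \<comment> \<open>\<open>z\<close> may be farther away than 6. All smaller distances occur too, so
    some vertex is at distance exactly 6.\<close>
  have descend: "\<exists>u\<in>V. d u = n" if "d v = n + k" "v \<in> V" for v n k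
    using that
  proof (induction k arbitrary: v)
    case (Suc k)
    then obtain u where "E u v" "d u = n + k" using pred[of v "n + k"] by auto
    then show ?case using Suc.IH[of u] edge_in by blast
  qed auto
  have "6 \<le> d z"
  proof (rule ccontr)
    assume "\<not> 6 \<le> d z"
    then have "d z \<le> 5" by simp
    then show False using neg walk[OF assms(2)] by blast
  qed
  then obtain v6 where v6: "v6 \<in> V" "d v6 = 6"
    using descend[of z 6 "d z - 6"] assms(2) by auto
  obtain v5 where v5: "E v5 v6" "d v5 = 5" using pred[of v6 5] v6 by auto
  obtain v4 where v4: "E v4 v5" "d v4 = 4" using pred[of v5 4] v5 edge_in by auto
  obtain v3 where v3: "E v3 v4" "d v3 = 3" using pred[of v4 3] v4 edge_in by auto
  obtain v2 where v2: "E v2 v3" "d v2 = 2" using pred[of v3 2] v3 edge_in by auto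
  obtain v1 where v1: "E v1 v2" "d v1 = 1" using pred[of v2 1] v2 edge_in by auto
  obtain v0 where v0: "E v0 v1" "d v0 = 0" using pred[of v1 0] v1 edge_in by auto
  show False
    by (rule P7[of v0 v1 v2 v3 v4 v5 v6]) (use v0 v1 v2 v3 v4 v5 v6 in \<open>simp_all add: nonadj\<close>)
qed

end

text \<open>The last two assumptions hold for a minimum vertex cover that induces as few isolated
  vertices as possible.\<close>
locale reduced_cover = pattern_free_graph +
  fixes C :: "'a set"
  assumes C_sub: "C \<subseteq> V"
    and cover: "E u v \<Longrightarrow> u \<in> C \<or> v \<in> C"
    and nbr: "x \<in> C \<Longrightarrow> \<exists>p. E x p"
    and second_nbr: "x \<in> C \<Longrightarrow> (\<And>c. c \<in> C \<Longrightarrow> \<not> E x c) \<Longrightarrow> E x p \<Longrightarrow> \<exists>p'. p' \<noteq> p \<and> E x p'"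
begin

section \<open>Isolated vertices of the cover and their distances\<close>

definition lone :: "'a set" where
  "lone = {x \<in> C. \<forall>c\<in>C. \<not> E x c}"

definition common_nbr :: "'a \<Rightarrow> 'a \<Rightarrow> bool" where
  "common_nbr x z \<longleftrightarrow> (\<exists>p. E x p \<and> E p z)"

lemma common_nbr_sym: "common_nbr x z \<Longrightarrow> common_nbr z x"
  unfolding common_nbr_def using sym by blast

lemma loneD: "x \<in> lone \<Longrightarrow> x \<in> C" "x \<in> lone \<Longrightarrow> E x p \<Longrightarrow> p \<notin> C" "x \<in> lone \<Longrightarrow> E p x \<Longrightarrow> p \<notin> C"
  by (auto simp: lone_def dest: sym)

lemma lone_nbr: "x \<in> lone \<Longrightarrow> \<exists>p. E x p"
  using nbr loneD by blast

lemma lone_second_nbr: "x \<in> lone \<Longrightarrow> E x p \<Longrightarrow> \<exists>p'. p' \<noteq> p \<and> E x p'"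
  using second_nbr loneD by metis

lemma cover1: "u \<notin> C \<Longrightarrow> E u v \<Longrightarrow> v \<in> C"
  using cover by blast

lemma cover2: "u \<notin> C \<Longrightarrow> v \<notin> C \<Longrightarrow> \<not> E u v"
  using cover by blast

lemma C_finite: "finite C"
  using C_sub fin by (rule finite_subset)

text \<open>Otherwise \<open>x - p - c - q - z\<close>, extended by further neighbours of \<open>x\<close> and of \<open>z\<close>, induces
  \<open>P\<^sub>7\<close>, \<open>\<Delta>\<^sub>2\<close> or \<open>\<Delta>\<^sub>1\<close>, depending on which of the two are adjacent to \<open>c\<close>.\<close>
lemma walk4:
  assumes x: "x \<in> lone" and z: "z \<in> lone" and "x \<noteq> z"
    and w: "E x p" "E p c" "E c q" "E q z"
  shows "common_nbr x z"
proof (rule ccontr)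
  assume neg: "\<not> common_nbr x z"
  obtain x' where x': "x' \<noteq> p" "E x x'" using lone_second_nbr[OF x w(1)] by blast
  obtain z' where z': "z' \<noteq> q" "E z z'" using lone_second_nbr[OF z] w(4) sym by blast
  have I: "p \<notin> C" "q \<notin> C" "x' \<notin> C" "z' \<notin> C"
    using loneD x z w x' z' by blast+
  have cC: "c \<in> C" using cover1[OF I(1)] w by blast
  have ns: "E x u \<Longrightarrow> \<not> E z u" for u using neg sym unfolding common_nbr_def by blast
  have nx: "\<not> E x q" "\<not> E x z'" "\<not> E z p" "\<not> E z x'"
    using ns w x' z' sym by blast+
  have nc: "\<not> E x c" "\<not> E z c" "\<not> E x z"
    using loneD x z cC by blast+
  have nI: "\<not> E p q" "\<not> E p x'" "\<not> E p z'" "\<not> E q x'" "\<not> E q z'" "\<not> E x' z'"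
    using cover2 I by blast+
  note facts = w x' z' nx nc nI
  have s: "E a b = E b a" for a b using sym by blast
  consider "\<not> E c x'" "\<not> E c z'" | "E c x'" "\<not> E c z'" | "\<not> E c x'" "E c z'" | "E c x'" "E c z'"
    by blast
  then show False
  proof cases
    case 1
    show False by (rule P7[of x' x p c q z z']) (use facts 1 in \<open>simp_all add: s\<close>)
  next
    case 2
    show False by (rule D2[of x' p z' z q c x]) (use facts 2 in \<open>simp_all add: s\<close>)
  next
    case 3
    show False by (rule D2[of z' q x' x p c z]) (use facts 3 in \<open>simp_all add: s\<close>)
  next
    case 4
    show False by (rule D1[of x' p z' q c x z]) (use facts 4 in \<open>simp_all add: s\<close>)
  qed
qed

text \<open>The two common neighbours form a walk of length four with middle vertex
  \<open>y\<close>, so \<open>walk4\<close> applies.\<close>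

lemma common_nbr_trans:
  assumes "x \<in> lone" "z \<in> lone" "x \<noteq> z" "common_nbr x y" "common_nbr y z"
  shows "common_nbr x z"
  using assms walk4 unfolding common_nbr_def by blast

text \<open>A Helly property: if no vertex served all three, the pairwise common neighbours would
  give an induced 6-cycle \<open>x - p - y - q - z - r\<close>, since \<open>x\<close>,
  \<open>y\<close>, \<open>z\<close> are pairwise nonadjacent and so are \<open>p\<close>,
  \<open>q\<close>, \<open>r\<close>.\<close>

lemma common_nbr_triple:
  assumes T: "x \<in> lone" "y \<in> lone" "z \<in> lone" and s: "common_nbr x y" "common_nbr y z" "common_nbr x z"
  shows "\<exists>w. E x w \<and> E y w \<and> E z w"
proof (rule ccontr)
  assume neg: "\<not> ?thesis"
  obtain p q r where w: "E x p" "E y p" "E y q" "E z q" "E x r" "E z r"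
    using s sym unfolding common_nbr_def by metis
  have I: "p \<notin> C" "q \<notin> C" "r \<notin> C" using loneD T w by blast+
  have n: "\<not> E p q" "\<not> E p r" "\<not> E q r" using cover2 I by blast+
  have n': "\<not> E z p" "\<not> E x q" "\<not> E y r" using neg w by blast+
  have n'': "\<not> E x y" "\<not> E y z" "\<not> E x z" using loneD T by blast+
  have s: "E a b = E b a" for a b using sym by blast
  show False by (rule C6[of x p y q z r]) (use w n n' n'' s in metis)+
qed

text \<open>The distance of \<open>x\<close> and \<open>z\<close> is then exactly 5; all shorter ones are excluded by \<open>walk4\<close>
  and by the independence of the complement of \<open>C\<close>.\<close>
lemma far_pair:
  assumes x: "x \<in> lone" and z: "z \<in> lone" and "x \<noteq> z" and neg: "\<not> common_nbr x z"
  obtains c d where "c \<in> C" "d \<in> C" "E c d" "\<And>p. E x p \<Longrightarrow> E p c" "\<And>q. E z q \<Longrightarrow> E q d"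
proof -
  have "x \<in> V" "z \<in> V" using x z loneD C_sub by blast+
  then obtain n where n: "n \<le> 5" "(E ^^ n) x z" using short_walk by blast
  have w4: False if "E x p" "E p c" "E c q" "E q z" for p c q
    using walk4[OF x z \<open>x \<noteq> z\<close> that] neg by blast
  have I: "p \<notin> C" if "E x p \<or> E p x \<or> E z p \<or> E p z" for p
    using that loneD x z by blast
  consider "n = 0" | "n = 1" | "n = 2" | "n = 3" | "n = 4" | "n = 5" using n(1) by linarith
  then show thesis
  proof cases
    case 1 then show ?thesis using n \<open>x \<noteq> z\<close> by simp
  next
    case 2 then show ?thesis using n loneD x z by auto
  next
    case 3
    then have "common_nbr x z" using n unfolding common_nbr_def by (auto simp: numeral_eq_Suc)
    then show ?thesis using neg by blast
  next
    case 4
    then obtain p q where "E x p" "E p q" "E q z" using n by (auto simp: numeral_eq_Suc)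
    then show ?thesis using cover I by blast
  next
    case 5
    then obtain p c q where "E x p" "E p c" "E c q" "E q z" using n by (auto simp: numeral_eq_Suc)
    then show ?thesis using w4 by blast
  next
    case 6
    then obtain p c d q where w: "E x p" "E p c" "E c d" "E d q" "E q z"
      using n by (auto simp: numeral_eq_Suc)
    have C: "c \<in> C" "d \<in> C" using w cover I by blast+
    \<comment> \<open>A neighbour \<open>x'\<close> of \<open>x\<close> missing \<open>c\<close>
      would start an induced path \<open>x' - x - p - c - d - q - z\<close>. The variables are
      general because the reversed walk gives the same for \<open>z\<close> and
      \<open>d\<close>.\<close>
    have key: "E x' c" if "x \<in> lone" "z \<in> lone" "\<not> common_nbr x z" "x \<noteq> z"
       "E x p" "E p c" "E c d" "E d q" "E q z" "c \<in> C" "d \<in> C" "E x x'" for x z p c d q x'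
    proof (rule ccontr)
      assume n: "\<not> E x' c"
      have I: "p \<notin> C" "q \<notin> C" "x' \<notin> C" using that loneD by blast+
      have nI: "\<not> E p q" "\<not> E p x'" "\<not> E q x'" using cover2 I by blast+
      have nc: "\<not> E x c" "\<not> E z c" "\<not> E x z" "\<not> E x d" "\<not> E z d" using that loneD by blast+
      have nx: "\<not> E x q" "\<not> E z x'" "\<not> E z p"
        using that sym unfolding common_nbr_def by blast+
      have "\<not> E p d" "\<not> E x' d" "\<not> E c q" using that walk4 by blast+
      note facts = that(5-9,12) n nI nc nx this
      have s: "E a b = E b a" for a b using sym by blast
      show False by (rule P7[of x' x p c d q z]) (use facts in \<open>simp_all add: s\<close>)
    qed
    show thesis
    proof (rule that[of c d])
      show "E p' c" if "E x p'" for p' using key[OF x z neg \<open>x \<noteq> z\<close> w C that] .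
      have "\<not> common_nbr z x" "z \<noteq> x" using neg common_nbr_sym \<open>x \<noteq> z\<close> by blast+
      note key' = key[OF z x this w(5,4,3,2,1)[THEN sym] C(2,1)]
      show "E q' d" if "E z q'" for q' using key'[OF that] .
    qed (use C w in auto)
  qed
qed

text \<open>If the two sides of \<open>y\<close> were in different components of the cover, they would
  extend to an induced \<open>P\<^sub>7\<close>.\<close>
lemma far_pairs_same_component:
  assumes T: "x \<in> lone" "y \<in> lone" "z \<in> lone" and ne: "x \<noteq> y" "y \<noteq> z" "x \<noteq> z"
    and ns: "\<not> common_nbr x y" "\<not> common_nbr y z" "\<not> common_nbr x z"
    and 1: "a \<in> C" "b \<in> C" "E a b" "\<And>p. E x p \<Longrightarrow> E p a" "\<And>p. E y p \<Longrightarrow> E p b"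
    and 2: "c \<in> C" "d \<in> C" "E c d" "\<And>p. E y p \<Longrightarrow> E p c" "\<And>p. E z p \<Longrightarrow> E p d"
  shows "reach E C b c"
proof (rule ccontr)
  assume neg: "\<not> reach E C b c"
  have nr: "\<not> E u v" if "u \<in> {a, b}" "v \<in> {c, d}" for u v
  proof
    assume "E u v"
    moreover have "reach E C b u" "reach E C v c"
      using that reach_edge[of b C a E] reach_edge[of d C c E] 1(1,2) 2(1,2) sym[OF 1(3)] sym[OF 2(3)]
      by auto
    moreover have "u \<in> C" "v \<in> C" using that 1(1,2) 2(1,2) by auto
    ultimately show False using neg reach_edge[of u C v E] by (blast intro: reach_trans)
  qed
  obtain p where p: "E x p" using lone_nbr T by blast
  obtain q where q: "E y q" using lone_nbr T by blast
  obtain r where r: "E z r" using lone_nbr T by blast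
  have I: "p \<notin> C" "q \<notin> C" using p q loneD T by blast+
  have nI: "\<not> E p q" using cover2 I by blast
  have nx: "\<not> E x a" "\<not> E x b" "\<not> E x c" "\<not> E x d" using loneD(2)[OF T(1)] 1(1,2) 2(1,2) by blast+
  have nxq: "\<not> E x q" using ns q sym unfolding common_nbr_def by blast
  \<comment> \<open>Each of these edges would complete a walk of length four between two of
    \<open>x\<close>, \<open>y\<close>, \<open>z\<close>; \<open>r\<close> is only needed for such
    walks ending in \<open>z\<close>.\<close>
  have npb: "\<not> E p b" "\<not> E p c"
    using walk4[OF T(1,2) ne(1) p _ sym sym[OF q]] ns(1) 1(5)[OF q] 2(4)[OF q] by blast+
  have npd: "\<not> E p d"
    using walk4[OF T(1,3) ne(3) p _ sym sym[OF r]] ns(3) 2(5)[OF r] by blast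
  have nqa: "\<not> E q a"
    using walk4[OF T(1,2) ne(1) p 1(4)[OF p] sym sym[OF q]] ns(1) by blast
  have nqd: "\<not> E q d"
    using walk4[OF T(2,3) ne(2) q _ sym sym[OF r]] ns(2) 2(5)[OF r] by blast
  have s: "E a b = E b a" for a b using sym by blast
  have "E p a" "E q b" "E q c" using 1(4)[OF p] 1(5)[OF q] 2(4)[OF q] by blast+
  note facts = this p nI nx nxq npb npd nqa nqd 1(3) 2(3)
  \<comment> \<open>\<open>y\<close> is not on the path: its neighbour \<open>q\<close> bridges the
    edges \<open>a b\<close> and \<open>c d\<close> of the cover.\<close>
  show False by (rule P7[of x p a b q c d]) (use facts nr in \<open>simp_all add: s\<close>)
qed

text \<open>Besides \<open>J\<close>, \<open>connect_anchored\<close> spends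
  \<open>card R - 1\<close> vertices; halved, the size condition says that both together are at most
  half of \<open>card C\<close>.\<close>

lemma extend_cover:
  assumes "J \<subseteq> V" "R \<subseteq> C" "R \<noteq> {}"
    and anchored: "\<And>s. s \<in> C \<union> J \<Longrightarrow> \<exists>r\<in>R. reach E (C \<union> J) r s"
    and size: "2 * card J + 2 * card R \<le> card C + 2"
  shows "\<exists>S. C \<subseteq> S \<and> S \<subseteq> V \<and> 2 * card S \<le> 3 * card C \<and> (\<forall>u\<in>S. \<forall>v\<in>S. reach E S u v)"
proof -
  have "\<exists>S. C \<union> J \<subseteq> S \<and> S \<subseteq> V \<and> card S + 1 \<le> card (C \<union> J) + card R
    \<and> (\<forall>u\<in>S. \<forall>v\<in>S. reach E S u v)"
    by (rule connect_anchored[of C]) (use cover assms C_sub in auto)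
  then obtain S where S: "C \<union> J \<subseteq> S" "S \<subseteq> V" "card S + 1 \<le> card (C \<union> J) + card R"
    "\<forall>u\<in>S. \<forall>v\<in>S. reach E S u v" by blast
  have "card (C \<union> J) \<le> card C + card J" by (rule card_Un_le)
  then have "2 * card S \<le> 3 * card C" using S(3) size by linarith
  then show ?thesis using S by blast
qed

lemma nontrivial_nbr: "u \<in> C - lone \<Longrightarrow> \<exists>v\<in>C - lone. E u v"
  using sym by (auto simp: lone_def)

text \<open>A class of \<open>m\<close> isolated vertices with pairwise common neighbours is joined internally at
  cost \<open>m div 2\<close>, so a single class leaves one unit per component of size at least 2. With several
  classes, each is attached to its own vertex of one component \<open>D\<close>, at cost \<open>(m + 1) div 2\<close>; the
  excess is paid by \<open>card D\<close>, and every other nontrivial component pays for its own connection.\<close>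
lemma connected_extension:
  assumes "C \<noteq> {}"
  shows "\<exists>S. C \<subseteq> S \<and> S \<subseteq> V \<and> 2 * card S \<le> 3 * card C \<and> (\<forall>u\<in>S. \<forall>v\<in>S. reach E S u v)"
proof -
  define rel where "rel y z \<longleftrightarrow> y = z \<or> common_nbr y z" for y z
  have rel_sym: "rel z y" if "rel y z" for y z using that common_nbr_sym by (auto simp: rel_def)
  have rel_trans: "rel x z" if "x \<in> lone" "z \<in> lone" "rel x y" "rel y z" for x y z
    using that common_nbr_trans by (auto simp: rel_def)
  \<comment> \<open>A representative of the class of \<open>y\<close>. Members of one class satisfy
    equal predicates, so the choice depends on the class only.\<close>
  define f where "f y = (SOME z. z \<in> lone \<and> rel y z)" for y
  have f: "f y \<in> lone" "rel y (f y)" if "y \<in> lone" for y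
  proof -
    have "y \<in> lone \<and> rel y y" using that by (simp add: rel_def)
    then have "f y \<in> lone \<and> rel y (f y)" unfolding f_def by (rule someI)
    then show "f y \<in> lone" "rel y (f y)" by auto
  qed
  have f_eq: "f y = f z" if "y \<in> lone" "z \<in> lone" "rel y z" for y z
  proof -
    have "(\<lambda>w. w \<in> lone \<and> rel y w) = (\<lambda>w. w \<in> lone \<and> rel z w)"
      using that rel_sym rel_trans by blast
    then show ?thesis unfolding f_def by simp
  qed
  have f_rel: "rel y z" if "y \<in> lone" "z \<in> lone" "f y = f z" for y z
    using that f rel_sym rel_trans by metis
  \<comment> \<open>Coinciding vertices have to be allowed: \<open>attach_pairs\<close> may present
    one vertex twice, and the representative may itself belong to the pair.\<close>
  have common: "\<exists>w. E w x \<and> E w y \<and> E w z"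
    if T: "x \<in> lone" "y \<in> lone" "z \<in> lone" and r: "rel x y" "rel y z" for x y z
  proof -
    have "rel x z" using T r rel_trans by blast
    then consider "common_nbr x y" "common_nbr y z" "common_nbr x z" | "x = y" "common_nbr y z" | "y = z" "common_nbr x y" | "x = z" "common_nbr x y"
      | "x = y" "y = z"
      using r by (auto simp: rel_def)
    then have "\<exists>w. E x w \<and> E y w \<and> E z w"
    proof cases
      case 1 then show ?thesis using common_nbr_triple T by blast
    next
      case 5 then show ?thesis using lone_nbr T by blast
    qed (auto simp: common_nbr_def dest: sym)
    then show ?thesis using sym by blast
  qed
  define X where "X = f ` lone"
  define A where "A x = {y \<in> lone. f y = x}" for x
  define U where "U = C - lone"
  have lone_C: "lone \<subseteq> C" using loneD by blast
  have flone: "finite lone" using lone_C C_finite by (rule finite_subset)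
  have fX: "finite X" unfolding X_def using flone by simp
  have fU: "finite U" unfolding U_def using C_finite by simp
  have cU: "card U + card lone = card C"
    unfolding U_def using card_Diff_subset[OF flone lone_C] card_mono[OF C_finite lone_C] by simp
  have U_nbr: "\<exists>v\<in>U. E u v" if "u \<in> U" for u
    using nontrivial_nbr that by (simp add: U_def)
  have X: "x \<in> lone" "f x = x" if "x \<in> X" for x
    using that f f_eq unfolding X_def by (metis imageE)+
  have X_far: "\<not> common_nbr x y" if "x \<in> X" "y \<in> X" "x \<noteq> y" for x y
    using that X f_eq[of x y] by (auto simp: rel_def)
  consider "lone = {}" | x where "X = {x}" | x y where "x \<in> X" "y \<in> X" "x \<noteq> y"
    unfolding X_def by blast
  then show ?thesis
  proof cases
    case 1
    then have "U = C" by (simp add: U_def)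
    then obtain R where R: "R \<subseteq> C" "2 * card R \<le> card C" "\<forall>u\<in>C. \<exists>r\<in>R. reach E C r u"
      using half_anchors[OF fU symp_E irreflp_E U_nbr] by auto
    show ?thesis
      by (rule extend_cover[of "{}" R]) (use R assms in auto)
  next
    case (2 x)
    then have x: "x \<in> lone" "f x = x" using X by auto
    have xrel: "rel x y" if "y \<in> lone" for y
    proof -
      have "f y \<in> X" using that by (simp add: X_def)
      then show ?thesis using 2 f_rel[OF x(1) that] x(2) by simp
    qed
    \<comment> \<open>The representative is the root, so only the other \<open>card lone - 1\<close>
      vertices are attached; this absorbs the \<open>+ 1\<close> of
      \<open>attach_pairs\<close>.\<close>
    have pairs: "\<exists>w. E w y \<and> E w y' \<and> E w x" if "y \<in> lone - {x}" "y' \<in> lone - {x}" for y y'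
      using common[of y x y'] xrel[of y] xrel[of y'] rel_sym that x by blast
    obtain J where J: "finite J" "2 * card J \<le> card (lone - {x}) + 1" "\<forall>w\<in>J. E w x"
      "\<forall>y\<in>lone - {x}. reach E (insert x ((lone - {x}) \<union> J)) x y"
      using attach_pairs[OF finite_Diff[OF flone] symp_E pairs] by blast
    obtain R where R: "R \<subseteq> U" "2 * card R \<le> card U" "\<forall>u\<in>U. \<exists>r\<in>R. reach E U r u"
      using half_anchors[OF fU symp_E irreflp_E U_nbr] by auto
    show ?thesis
    proof (rule extend_cover[of J "insert x R"])
      show "J \<subseteq> V" using J edge_in by blast
      show "insert x R \<subseteq> C" using R x lone_C by (auto simp: U_def)
      have "finite R" using R(1) fU by (rule finite_subset)
      then have "card (insert x R) \<le> card R + 1" by (simp add: card_insert_if)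
      moreover have "card (lone - {x}) + 1 = card lone" using flone x by (metis card_Suc_Diff1 Suc_eq_plus1)
      ultimately show "2 * card J + 2 * card (insert x R) \<le> card C + 2"
        using J(2) R(2) cU by linarith
      fix s assume "s \<in> C \<union> J"
      then consider "s \<in> U" | "s = x" | "s \<in> lone - {x}" | "s \<in> J" by (auto simp: U_def)
      then show "\<exists>r\<in>insert x R. reach E (C \<union> J) r s"
      proof cases
        case 1
        then obtain r where "r \<in> R" "reach E U r s" using R by blast
        then show ?thesis using reach_mono[of E U r s "C \<union> J"] by (auto simp: U_def)
      next
        case 3
        then have "reach E (insert x ((lone - {x}) \<union> J)) x s" using J by blast
        then have "reach E (C \<union> J) x s" by (rule reach_mono) (use x lone_C in auto)
        then show ?thesis by blast
      next
        case 4
        then have "reach E (C \<union> J) x s" using J sym x lone_C by (intro reach_edge) auto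
        then show ?thesis by blast
      qed auto
    qed simp
  next
    case (3 x0 y0)
    have "\<forall>y\<in>X - {x0}. \<exists>c d. c \<in> C \<and> d \<in> C \<and> E c d \<and> (\<forall>p. E x0 p \<longrightarrow> E p c)
      \<and> (\<forall>q. E y q \<longrightarrow> E q d)"
    proof
      fix y assume y: "y \<in> X - {x0}"
      obtain c d where "c \<in> C" "d \<in> C" "E c d" "\<And>p. E x0 p \<Longrightarrow> E p c" "\<And>q. E y q \<Longrightarrow> E q d"
        using far_pair[of x0 y] y X X_far 3 by (metis DiffD1 DiffD2 insertI1)
      then show "\<exists>c d. c \<in> C \<and> d \<in> C \<and> E c d \<and> (\<forall>p. E x0 p \<longrightarrow> E p c) \<and> (\<forall>q. E y q \<longrightarrow> E q d)"
        by blast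
    qed
    from bchoice[OF this] obtain c where "\<forall>y\<in>X - {x0}. \<exists>d. c y \<in> C \<and> d \<in> C \<and> E (c y) d
      \<and> (\<forall>p. E x0 p \<longrightarrow> E p (c y)) \<and> (\<forall>q. E y q \<longrightarrow> E q d)" by blast
    from bchoice[OF this] obtain d where cd': "\<forall>y\<in>X - {x0}. c y \<in> C \<and> d y \<in> C \<and> E (c y) (d y)
      \<and> (\<forall>p. E x0 p \<longrightarrow> E p (c y)) \<and> (\<forall>q. E y q \<longrightarrow> E q (d y))" by blast
    have cd: "c y \<in> C" "d y \<in> C" "E (c y) (d y)"
        "\<And>p. E x0 p \<Longrightarrow> E p (c y)" "\<And>q. E y q \<Longrightarrow> E q (d y)"
      if "y \<in> X - {x0}" for y using bspec[OF cd' that] by blast+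
    have y0: "y0 \<in> X - {x0}" using 3 by blast
    define r0 where "r0 = c y0"
    define D where "D = {v \<in> C. reach E C r0 v}"
    \<comment> \<open>\<open>\<rho> x\<close> is adjacent to every neighbour of \<open>x\<close>, so
      a connector chosen next to \<open>x\<close> also touches \<open>\<rho> x\<close>, which can
      replace \<open>x\<close> as the root of its class. For \<open>x0\<close> itself
      \<open>c y0\<close> has this property.\<close>
    define \<rho> where "\<rho> x = (if x = x0 then r0 else d x)" for x
    have dD: "d y \<in> D" if y: "y \<in> X - {x0}" for y
    proof -
      have "reach E C r0 (c y)"
      proof (cases "y = y0")
        case False
        \<comment> \<open>\<open>x0\<close> is the middle one of the three, with the walk from
          \<open>x0\<close> to \<open>y0\<close> read backwards; \<open>c y0\<close> and
          \<open>c y\<close> are then the two sides of \<open>x0\<close>.\<close>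
        show ?thesis
          unfolding r0_def
          by (rule far_pairs_same_component[of y0 x0 y "d y0" "c y0" "c y" "d y"])
            (use X X_far 3 y False cd[OF y0] cd[OF y] sym in blast)+
      qed (simp add: r0_def)
      then show ?thesis
        using cd[OF y] reach_trans reach_edge[of "c y" C "d y" E] by (fastforce simp: D_def)
    qed
    have r0: "r0 \<in> C" "r0 \<in> D" using cd[OF y0] by (auto simp: D_def r0_def)
    have \<rho>D: "\<rho> x \<in> D" if "x \<in> X" for x using that dD r0 by (auto simp: \<rho>_def)
    have \<rho>_nbr: "E p (\<rho> x)" if "x \<in> X" "E x p" for x p
      using that cd[OF y0] cd(5)[of x] by (auto simp: \<rho>_def r0_def)
    \<comment> \<open>A shared value would be the middle of a walk of length four and merge two
      classes. Injectivity bounds the number of classes by \<open>card D\<close>.\<close>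
    have \<rho>_inj: "inj_on \<rho> X"
    proof (rule inj_onI, rule ccontr)
      fix x y assume *: "x \<in> X" "y \<in> X" "\<rho> x = \<rho> y" "x \<noteq> y"
      obtain p where p: "E x p" using lone_nbr X * by blast
      obtain q where q: "E y q" using lone_nbr X * by blast
      have "E p (\<rho> x)" "E (\<rho> x) q" using \<rho>_nbr[OF _ p] \<rho>_nbr[OF _ q] * sym by auto
      then have "common_nbr x y" using walk4[of x y p "\<rho> x" q] p q sym X * by blast
      then show False using X_far * by blast
    qed
    have DU: "D \<subseteq> U"
    proof
      fix v assume "v \<in> D"
      then have "reach E C r0 v" by (simp add: D_def)
      then show "v \<in> U"
      proof (rule reach_closed)
        show "r0 \<in> U" using cd[OF y0] loneD by (auto simp: U_def r0_def)
        show "b \<in> U" if "a \<in> U" "a \<in> C" "b \<in> C" "E a b" for a b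
          using that loneD by (auto simp: U_def)
      qed
    qed
    have fD: "finite D" using DU fU by (rule finite_subset)
    have cD: "card (U - D) + card D = card U"
      using card_Diff_subset[OF fD DU] card_mono[OF fU DU] by simp
    have "\<forall>x\<in>X. \<exists>J. finite J \<and> 2 * card J \<le> card (A x) + 1 \<and> (\<forall>w\<in>J. E w (\<rho> x))
      \<and> (\<forall>y\<in>A x. reach E (insert (\<rho> x) (A x \<union> J)) (\<rho> x) y)"
    proof
      fix x assume x: "x \<in> X"
      show "\<exists>J. finite J \<and> 2 * card J \<le> card (A x) + 1 \<and> (\<forall>w\<in>J. E w (\<rho> x))
        \<and> (\<forall>y\<in>A x. reach E (insert (\<rho> x) (A x \<union> J)) (\<rho> x) y)"
      proof (rule attach_pairs)
        show "finite (A x)" using flone by (simp add: A_def)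
        fix y y' assume "y \<in> A x" "y' \<in> A x"
        then have "y \<in> lone" "y' \<in> lone" "f y = x" "f y' = x" by (auto simp: A_def)
        then obtain w where "E w y" "E w y'" "E w x"
          using common[of y y' x] f_rel[of y y'] f_rel[of y' x] X[OF x] by auto
        then show "\<exists>w. E w y \<and> E w y' \<and> E w (\<rho> x)" using \<rho>_nbr[OF x] sym by blast
      qed (rule symp_E)
    qed
    from bchoice[OF this] obtain J where J': "\<forall>x\<in>X. finite (J x) \<and> 2 * card (J x) \<le> card (A x) + 1
      \<and> (\<forall>w\<in>J x. E w (\<rho> x)) \<and> (\<forall>y\<in>A x. reach E (insert (\<rho> x) (A x \<union> J x)) (\<rho> x) y)" by blast
    have J: "finite (J x)" "2 * card (J x) \<le> card (A x) + 1" "\<forall>w\<in>J x. E w (\<rho> x)"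
        "\<forall>y\<in>A x. reach E (insert (\<rho> x) (A x \<union> J x)) (\<rho> x) y"
      if "x \<in> X" for x using bspec[OF J' that] by blast+
    have UD_nbr: "\<exists>v\<in>U - D. E u v" if u: "u \<in> U - D" for u
    proof -
      obtain v where v: "v \<in> U" "E u v" using U_nbr u by blast
      have "v \<notin> D"
      proof
        assume "v \<in> D"
        then have "reach E C r0 v" by (simp add: D_def)
        moreover have "reach E C v u" using u v sym by (intro reach_edge) (auto simp: U_def)
        ultimately show False using u by (auto simp: D_def U_def intro: reach_trans)
      qed
      then show ?thesis using v by blast
    qed
    obtain R where R: "R \<subseteq> U - D" "2 * card R \<le> card (U - D)"
      "\<forall>u\<in>U - D. \<exists>r\<in>R. reach E (U - D) r u"
      using half_anchors[OF finite_Diff[OF fU] symp_E irreflp_E UD_nbr] by auto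
    let ?J = "\<Union>x\<in>X. J x"
    show ?thesis
    proof (rule extend_cover[of ?J "insert r0 R"])
      show "?J \<subseteq> V" using J edge_in by blast
      show "insert r0 R \<subseteq> C" using R r0 by (auto simp: U_def)
      have "finite R" using R(1) fU by (meson finite_Diff finite_subset)
      then have "card (insert r0 R) \<le> card R + 1" by (simp add: card_insert_if)
      moreover have "2 * card ?J \<le> card lone + card X"
      proof -
        have "card ?J \<le> (\<Sum>x\<in>X. card (J x))" using fX by (rule card_UN_le)
        then have "2 * card ?J \<le> (\<Sum>x\<in>X. 2 * card (J x))" by (simp add: sum_distrib_left[symmetric])
        also have "\<dots> \<le> (\<Sum>x\<in>X. card (A x) + 1)" using J by (intro sum_mono) auto
        also have "\<dots> = (\<Sum>x\<in>X. card (A x)) + card X" unfolding sum.distrib by simp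
        also have "(\<Sum>x\<in>X. card (A x)) = card (\<Union>x\<in>X. A x)"
          using fX flone by (intro card_UN_disjoint[symmetric]) (auto simp: A_def)
        also have "(\<Union>x\<in>X. A x) = lone" by (auto simp: A_def X_def)
        finally show ?thesis .
      qed
      moreover have "card X \<le> card D"
        using \<rho>_inj \<rho>D fD by (intro card_inj_on_le[of \<rho>]) auto
      \<comment> \<open>\<open>lone\<close> and \<open>D\<close> pay for \<open>?J\<close>,
        \<open>U - D\<close> pays for \<open>R\<close>, and the summand 2 pays for
        \<open>r0\<close>.\<close>
      ultimately show "2 * card ?J + 2 * card (insert r0 R) \<le> card C + 2"
        using R(2) cU cD by linarith
      have root: "reach E (C \<union> ?J) r0 (\<rho> x)" "\<rho> x \<in> C" if "x \<in> X" for x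
        using \<rho>D[OF that] reach_mono[of E C r0 "\<rho> x" "C \<union> ?J"] by (auto simp: D_def)
      fix s assume "s \<in> C \<union> ?J"
      then consider "s \<in> U - D" | "s \<in> D" | "s \<in> lone" | x where "x \<in> X" "s \<in> J x"
        by (auto simp: U_def)
      then show "\<exists>r\<in>insert r0 R. reach E (C \<union> ?J) r s"
      proof cases
        case 1
        then obtain r where "r \<in> R" "reach E (U - D) r s" using R by blast
        then show ?thesis using reach_mono[of E "U - D" r s "C \<union> ?J"] by (auto simp: U_def)
      next
        case 2
        then have "reach E C r0 s" by (simp add: D_def)
        then have "reach E (C \<union> ?J) r0 s" by (rule reach_mono) auto
        then show ?thesis by blast
      next
        case 3
        let ?x = "f s"
        have x: "?x \<in> X" "s \<in> A ?x" using 3 by (auto simp: X_def A_def)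
        then have "reach E (insert (\<rho> ?x) (A ?x \<union> J ?x)) (\<rho> ?x) s" using J by blast
        then have "reach E (C \<union> ?J) (\<rho> ?x) s"
          by (rule reach_mono) (use x root lone_C in \<open>auto simp: A_def\<close>)
        then show ?thesis using root x by (blast intro: reach_trans)
      next
        case (4 x)
        then have "reach E (C \<union> ?J) (\<rho> x) s" using J root sym by (intro reach_edge) auto
        then show ?thesis using root 4 by (blast intro: reach_trans)
      qed
    qed simp
  qed
qed

end

section \<open>Choice of the cover and the bound for a connected graph\<close>

context pattern_free_graph begin

definition covering :: "'a set \<Rightarrow> bool" where
  "covering C \<longleftrightarrow> C \<subseteq> V \<and> (\<forall>u v. E u v \<longrightarrow> u \<in> C \<or> v \<in> C)"

text \<open>If \<open>p\<close> were the only neighbour of an isolated vertex \<open>x\<close> of the cover, exchanging \<open>x\<close> for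
  \<open>p\<close> would give a cover of the same size with fewer isolated vertices.\<close>
lemma reduced_cover_exists:
  assumes "covering K"
  shows "\<exists>C. covering C \<and> card C \<le> card K \<and> (card C \<le> 1 \<or> reduced_cover V E C)"
proof -
  let ?min = "\<lambda>C. covering C \<and> (\<forall>C'. covering C' \<longrightarrow> card C \<le> card C')"
  let ?T = "\<lambda>C. {x \<in> C. \<forall>c\<in>C. \<not> E x c}"
  from ex_has_least_nat[of covering K card, OF assms] obtain C0 where "?min C0" ..
  \<comment> \<open>The second minimization ranges over minimum covers only, so the size cannot
    grow.\<close>
  from ex_has_least_nat[of ?min C0 "\<lambda>C. card (?T C)", OF this]
  obtain C where "?min C \<and> (\<forall>C'. ?min C' \<longrightarrow> card (?T C) \<le> card (?T C'))" ..
  note C = conjunct1[OF this] conjunct2[OF this]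
  have cov: "u \<in> C \<or> v \<in> C" if "E u v" for u v
    using C(1) that by (auto simp: covering_def)
  have CV: "C \<subseteq> V" using C(1) by (auto simp: covering_def)
  have fC: "finite C" using CV fin by (rule finite_subset)
  \<comment> \<open>One-vertex covers are exempt: in a graph with a single edge the exchange gains
    nothing and no vertex has a second neighbour.\<close>
  have "reduced_cover V E C" if "\<not> card C \<le> 1"
  proof
    show "C \<subseteq> V" by (rule CV)
    show "u \<in> C \<or> v \<in> C" if "E u v" for u v using cov that .
    show "\<exists>p. E x p" if x: "x \<in> C" for x
    proof (rule ccontr)
      assume "\<nexists>p. E x p"
      then have "covering (C - {x})" using CV cov sym unfolding covering_def by blast
      then have "card C \<le> card (C - {x})" using C(1) by blast
      then show False using card_Diff1_less[OF fC x] by linarith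
    qed
    show "\<exists>p'. p' \<noteq> p \<and> E x p'" if x: "x \<in> C" "\<And>c. c \<in> C \<Longrightarrow> \<not> E x c" "E x p" for x p
    proof (rule ccontr)
      assume "\<nexists>p'. p' \<noteq> p \<and> E x p'"
      then have only: "p' = p" if "E x p'" for p' using that by blast
      have pC: "p \<notin> C" using x by blast
      let ?C' = "insert p (C - {x})"
      have pV: "p \<in> V" using x edge_in sym by blast
      have "u \<in> ?C' \<or> v \<in> ?C'" if "E u v" for u v
        using cov[OF that] only[of u] only[of v] that sym by blast
      then have covering': "covering ?C'" using CV pV unfolding covering_def by blast
      have "card ?C' = Suc (card (C - {x}))" using fC pC by simp
      then have "card ?C' = card C" using card_Suc_Diff1[OF fC x(1)] by simp
      then have min': "?min ?C'" using covering' C(1) by simp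
      have "\<exists>c\<in>C - {x}. E p c"
      proof (rule ccontr)
        assume neg: "\<not> ?thesis"
        have "V \<subseteq> {x, p}"
        proof (rule closed_eq_V)
          show "x \<in> V" using x CV by blast
          fix a b assume "a \<in> {x, p}" "E a b"
          then show "b \<in> {x, p}" using neg only cov[of a b] pC by blast
        qed simp
        then have "C \<subseteq> {x}" using CV pC by blast
        then have "card C \<le> 1" using card_mono[of "{x}" C] by simp
        then show False using \<open>\<not> card C \<le> 1\<close> by simp
      qed
      then obtain c where c: "c \<in> C" "c \<noteq> x" "E p c" by blast
      \<comment> \<open>\<open>x\<close> is removed, \<open>p\<close> is not isolated because of
        \<open>c\<close>, and no other vertex becomes isolated, since \<open>x\<close> has no
        neighbour but \<open>p\<close>.\<close>
      have "?T ?C' \<subset> ?T C"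
      proof
        show "?T ?C' \<subseteq> ?T C"
        proof
          fix y assume y: "y \<in> ?T ?C'"
          then have "y \<noteq> p" using c by blast
          then have "y \<in> C" using y by blast
          moreover have "\<not> E y x" using only \<open>y \<noteq> p\<close> sym by blast
          ultimately show "y \<in> ?T C" using y by blast
        qed
        have "x \<in> ?T C" "x \<notin> ?T ?C'" using x pC by auto
        then show "?T ?C' \<noteq> ?T C" by blast
      qed
      then have "card (?T ?C') < card (?T C)" using fC by (intro psubset_card_mono) auto
      then show False using mp[OF spec[OF C(2)] min'] by linarith
    qed
  qed
  moreover have "card C \<le> card K" using C(1) assms by blast
  ultimately show ?thesis using C(1) by blast
qed

lemma connected_cover_exists:
  assumes "covering K" and "E a b"
  shows "\<exists>S. covering S \<and> S \<noteq> {} \<and> 2 * card S \<le> 3 * card K \<and> (\<forall>u\<in>S. \<forall>v\<in>S. reach E S u v)"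
proof -
  obtain C where C: "covering C" "card C \<le> card K" "card C \<le> 1 \<or> reduced_cover V E C"
    using reduced_cover_exists[OF assms(1)] by blast
  have ne: "C \<noteq> {}" using C(1) assms(2) by (auto simp: covering_def)
  have fC: "finite C" using C(1) fin by (auto simp: covering_def intro: finite_subset)
  show ?thesis
  proof (cases "card C \<le> 1")
    case True
    then have "card C = 1" using ne fC by (simp add: card_gt_0_iff le_antisym Suc_leI)
    then obtain x where "C = {x}" by (auto simp: card_1_singleton_iff)
    then show ?thesis using C by (intro exI[of _ C]) auto
  next
    case False
    then interpret reduced_cover V E C using C by blast
    obtain S where S: "C \<subseteq> S" "S \<subseteq> V" "2 * card S \<le> 3 * card C" "\<forall>u\<in>S. \<forall>v\<in>S. reach E S u v"
      using connected_extension[OF ne] by blast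
    then have "covering S" using C(1) unfolding covering_def by blast
    then show ?thesis using S C(2) ne by (intro exI[of _ S]) auto
  qed
qed

end

section \<open>Induced copies of the patterns\<close>

text \<open>An induced copy of \<open>graph_of n F\<close> as a map on vertices alone.
  \<open>F\<close> lists each edge in one direction, hence the disjunction.\<close>

definition embeds :: "('a, 'b) pre_digraph \<Rightarrow> nat \<Rightarrow> nat rel \<Rightarrow> (nat \<Rightarrow> 'a) \<Rightarrow> bool" where
  "embeds G n F f \<longleftrightarrow> inj_on f {..<n} \<and> f ` {..<n} \<subseteq> verts G \<and>
     (\<forall>i<n. \<forall>j<n. f i \<rightarrow>\<^bsub>G\<^esub> f j \<longleftrightarrow> (i, j) \<in> F \<or> (j, i) \<in> F)"

lemma graph_induced_subgraph:
  assumes "graph G" "induced_subgraph H G"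
  shows "graph H"
proof -
  interpret graph G by fact
  interpret H: digraph H using assms(2) by (rule digraphI_induced)
  interpret H: sym_digraph H using assms(2) by (rule induced_graph_imp_graph)
  show ?thesis by unfold_locales
qed

lemma dominates_induced:
  assumes "induced_subgraph H G"
  shows "u \<rightarrow>\<^bsub>H\<^esub> v \<longleftrightarrow> u \<in> verts H \<and> v \<in> verts H \<and> u \<rightarrow>\<^bsub>G\<^esub> v"
proof -
  have "arcs H = {e \<in> arcs G. tail G e \<in> verts H \<and> head G e \<in> verts H}" "compatible G H"
    using assms unfolding induced_subgraph_def subgraph_def by blast+
  then show ?thesis unfolding arcs_ends_conv compatible_def by auto
qed

lemma dominates_induce [simp]:
  "u \<rightarrow>\<^bsub>G \<restriction> S\<^esub> v \<longleftrightarrow> u \<in> S \<and> v \<in> S \<and> u \<rightarrow>\<^bsub>G\<^esub> v"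
  by (auto simp: arcs_ends_conv)

text \<open>From an isomorphism, the inverse of its vertex map is the embedding. Conversely an
  embedding yields the subgraph induced by its image; an arc is sent to the pair of its ends,
  injectively because there are no parallel arcs.\<close>

lemma contains_induced_graph_of:
  assumes "graph G" and F: "F \<subseteq> {..<n} \<times> {..<n}"
  shows "contains_induced G (with_proj (graph_of n F)) \<longleftrightarrow> (\<exists>f. embeds G n F f)"
proof
  interpret graph G by fact
  assume "contains_induced G (with_proj (graph_of n F))"
  then obtain H hom where H: "induced_subgraph H G"
    and hom: "pre_digraph.digraph_isomorphism H hom"
    and P: "with_proj (graph_of n F) = app_iso hom H"
    unfolding contains_induced_def digraph_iso_def by blast
  interpret H: graph H using assms(1) H by (rule graph_induced_subgraph)
  have v: "{..<n} = iso_verts hom ` verts H"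
    using arg_cong[OF P, of verts] by (simp add: graph_of_def)
  have a: "F \<union> F\<inverse> = iso_arcs hom ` arcs H"
    using arg_cong[OF P, of arcs] by (simp add: graph_of_def)
  have t: "iso_tail hom = fst" "iso_head hom = snd"
    using arg_cong[OF P, of tail] arg_cong[OF P, of head] by simp_all
  have inj: "inj_on (iso_verts hom) (verts H)"
    using H.digraph_isomorphism_inj_on_verts[OF hom] .
  define f where "f = the_inv_into (verts H) (iso_verts hom)"
  have f: "f (iso_verts hom u) = u" if "u \<in> verts H" for u
    unfolding f_def using inj that by (rule the_inv_into_f_f)
  have adj: "u \<rightarrow>\<^bsub>H\<^esub> w \<longleftrightarrow> (iso_verts hom u, iso_verts hom w) \<in> F \<union> F\<inverse>"
    if "u \<in> verts H" "w \<in> verts H" for u w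
  proof
    assume "u \<rightarrow>\<^bsub>H\<^esub> w"
    then obtain e where e: "e \<in> arcs H" "tail H e = u" "head H e = w" by auto
    then have "iso_arcs hom e = (iso_verts hom u, iso_verts hom w)"
      using H.iso_verts_tail[OF hom e(1)] H.iso_verts_head[OF hom e(1)] t
      by (metis prod.collapse)
    then show "(iso_verts hom u, iso_verts hom w) \<in> F \<union> F\<inverse>" using a e(1) by (metis imageI)
  next
    assume "(iso_verts hom u, iso_verts hom w) \<in> F \<union> F\<inverse>"
    then obtain e where e: "e \<in> arcs H" "iso_arcs hom e = (iso_verts hom u, iso_verts hom w)"
      unfolding a by auto
    then have "iso_verts hom (tail H e) = iso_verts hom u" "iso_verts hom (head H e) = iso_verts hom w"
      using H.iso_verts_tail[OF hom e(1)] H.iso_verts_head[OF hom e(1)] t by simp_all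
    then have "tail H e = u" "head H e = w"
      using inj that e(1) by (auto dest: inj_onD)
    then show "u \<rightarrow>\<^bsub>H\<^esub> w" using e(1) by (auto simp: arcs_ends_conv)
  qed
  have HG: "verts H \<subseteq> verts G" using H by (auto simp: induced_subgraph_def subgraph_def)
  have fi: "f i \<in> verts H" "iso_verts hom (f i) = i" if "i < n" for i
  proof -
    from that have "i \<in> iso_verts hom ` verts H" using v by blast
    then show "f i \<in> verts H" "iso_verts hom (f i) = i" using f by auto
  qed
  have "embeds G n F f"
    unfolding embeds_def
  proof (intro conjI allI impI)
    show "inj_on f {..<n}" using fi by (metis inj_onI lessThan_iff)
    show "f ` {..<n} \<subseteq> verts G" using fi HG by blast
    show "f i \<rightarrow>\<^bsub>G\<^esub> f j \<longleftrightarrow> (i, j) \<in> F \<or> (j, i) \<in> F" if "i < n" "j < n" for i j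
      using adj[of "f i" "f j"] fi[OF that(1)] fi[OF that(2)] dominates_induced[OF H] by auto
  qed
  then show "\<exists>f. embeds G n F f" by blast
next
  interpret graph G by fact
  assume "\<exists>f. embeds G n F f"
  then obtain f where f: "inj_on f {..<n}" "f ` {..<n} \<subseteq> verts G"
    and adj: "\<And>i j. i < n \<Longrightarrow> j < n \<Longrightarrow> f i \<rightarrow>\<^bsub>G\<^esub> f j \<longleftrightarrow> (i, j) \<in> F \<or> (j, i) \<in> F"
    unfolding embeds_def by blast
  define H where "H = G \<restriction> (f ` {..<n})"
  define g where "g = the_inv_into {..<n} f"
  have H: "induced_subgraph H G" unfolding H_def using f(2) by (rule induced_induce)
  interpret H: graph H using assms(1) H by (rule graph_induced_subgraph)
  have gf: "g (f i) = i" if "i < n" for i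
    unfolding g_def using f(1) that by (intro the_inv_into_f_f) auto
  have fg: "f (g u) = u" if "u \<in> f ` {..<n}" for u
    unfolding g_def using f(1) that by (rule f_the_inv_into_f)
  define hom where "hom = \<lparr>iso_verts = g, iso_arcs = \<lambda>e. (g (tail G e), g (head G e)),
    iso_head = snd, iso_tail = fst\<rparr>"
  have "inj_on (\<lambda>e. (g (tail G e), g (head G e))) (arcs H)"
  proof (rule inj_onI)
    fix e e' assume e: "e \<in> arcs H" "e' \<in> arcs H"
      and eq: "(g (tail G e), g (head G e)) = (g (tail G e'), g (head G e'))"
    have ends: "tail G e \<in> f ` {..<n}" "tail G e' \<in> f ` {..<n}"
      "head G e \<in> f ` {..<n}" "head G e' \<in> f ` {..<n}"
      using e by (auto simp only: H_def induce_subgraph_arcs)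
    have "f (g (tail G e)) = f (g (tail G e'))" "f (g (head G e)) = f (g (head G e'))"
      using eq by simp_all
    then have "tail G e = tail G e'" "head G e = head G e'"
      unfolding fg[OF ends(1)] fg[OF ends(2)] fg[OF ends(3)] fg[OF ends(4)] .
    then have "arc_to_ends G e = arc_to_ends G e'" by (simp add: arc_to_ends_def)
    then show "e = e'" using e no_multi_arcs unfolding H_def by simp
  qed
  moreover have "inj_on g (f ` {..<n})" using gf by (auto simp: inj_on_def)
  ultimately have iso: "H.digraph_isomorphism hom"
    unfolding H.digraph_isomorphism_def
    using H.wf_digraph by (simp add: hom_def) (simp add: H_def)
  have "(\<lambda>e. (g (tail G e), g (head G e))) ` arcs H = F \<union> F\<inverse>"
  proof (intro set_eqI iffI)
    fix x assume "x \<in> (\<lambda>e. (g (tail G e), g (head G e))) ` arcs H"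
    then obtain e where e: "e \<in> arcs H" "x = (g (tail G e), g (head G e))" by blast
    then obtain i j where ij: "i < n" "j < n" "tail G e = f i" "head G e = f j" "e \<in> arcs G"
      by (auto simp: H_def)
    then have "f i \<rightarrow>\<^bsub>G\<^esub> f j" by (metis in_arcs_imp_in_arcs_ends)
    then show "x \<in> F \<union> F\<inverse>" using adj ij e gf by auto
  next
    fix x assume x: "x \<in> F \<union> F\<inverse>"
    then obtain i j where ij: "x = (i, j)" "i < n" "j < n" using F by (cases x) auto
    then have "f i \<rightarrow>\<^bsub>G\<^esub> f j" using x adj by auto
    then obtain e where "e \<in> arcs G" "tail G e = f i" "head G e = f j" by auto
    then show "x \<in> (\<lambda>e. (g (tail G e), g (head G e))) ` arcs H"
      using ij gf by (intro image_eqI[of _ _ e]) (auto simp: H_def)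
  qed
  moreover have "g ` f ` {..<n} = {..<n}" using gf by (auto simp: image_image)
  ultimately have "with_proj (graph_of n F) = app_iso hom H"
    by (simp add: with_proj_def graph_of_def app_iso_def hom_def) (simp add: H_def)
  then show "contains_induced G (with_proj (graph_of n F))"
    unfolding contains_induced_def digraph_iso_def using H iso by blast
qed

lemma embeds_induced:
  assumes "induced_subgraph H G" "embeds H n F f"
  shows "embeds G n F f"
proof -
  have "verts H \<subseteq> verts G" using assms(1) by (auto simp: induced_subgraph_def subgraph_def)
  moreover have fH: "f i \<in> verts H" if "i < n" for i
    using assms(2) that by (auto simp: embeds_def)
  ultimately have "f ` {..<n} \<subseteq> verts G" by blast
  moreover have "f i \<rightarrow>\<^bsub>G\<^esub> f j \<longleftrightarrow> f i \<rightarrow>\<^bsub>H\<^esub> f j" if "i < n" "j < n" for i j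
    using dominates_induced[OF assms(1), of "f i" "f j"] fH that by blast
  ultimately show ?thesis using assms(2) unfolding embeds_def by blast
qed

lemma embeds_nth:
  assumes "length xs = n" "distinct xs" "set xs \<subseteq> verts G"
    and "\<forall>i<n. \<forall>j<n. xs ! i \<rightarrow>\<^bsub>G\<^esub> xs ! j \<longleftrightarrow> (i, j) \<in> F \<or> (j, i) \<in> F"
  shows "embeds G n F (nth xs)"
  unfolding embeds_def
proof (intro conjI)
  show "inj_on (nth xs) {..<n}" using assms(1,2) by (intro inj_on_nth) auto
  show "nth xs ` {..<n} \<subseteq> verts G" using assms(1,3) nth_mem by blast
qed (rule assms(4))

lemma All_less_6: "(\<forall>i<6::nat. P i) \<longleftrightarrow> P 0 \<and> P 1 \<and> P 2 \<and> P 3 \<and> P 4 \<and> P 5"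
proof -
  have "{..<6::nat} = {0,1,2,3,4,5}" by (auto simp: lessThan_nat_numeral lessThan_Suc)
  then have "(\<forall>i\<in>{..<6}. P i) \<longleftrightarrow> P 0 \<and> P 1 \<and> P 2 \<and> P 3 \<and> P 4 \<and> P 5" by simp
  then show ?thesis by (simp add: Ball_def)
qed

lemma All_less_7: "(\<forall>i<7::nat. P i) \<longleftrightarrow> P 0 \<and> P 1 \<and> P 2 \<and> P 3 \<and> P 4 \<and> P 5 \<and> P 6"
proof -
  have "{..<7::nat} = {0,1,2,3,4,5,6}" by (auto simp: lessThan_nat_numeral lessThan_Suc)
  then have "(\<forall>i\<in>{..<7}. P i) \<longleftrightarrow> P 0 \<and> P 1 \<and> P 2 \<and> P 3 \<and> P 4 \<and> P 5 \<and> P 6" by simp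
  then show ?thesis by (simp add: Ball_def)
qed

abbreviation P7_edges :: "nat rel" where
  "P7_edges \<equiv> {(0,1), (1,2), (2,3), (3,4), (4,5), (5,6)}"

abbreviation C6_edges :: "nat rel" where
  "C6_edges \<equiv> {(0,1), (1,2), (2,3), (3,4), (4,5), (5,0)}"

abbreviation D1_edges :: "nat rel" where
  "D1_edges \<equiv> {(0,1), (1,2), (2,3), (3,0), (0,4), (4,5), (5,6), (6,0)}"

abbreviation D2_edges :: "nat rel" where
  "D2_edges \<equiv> {(1,2), (2,3), (3,0), (0,4), (4,5), (5,6), (6,0)}"

lemma pattern_graph_of:
  "path_graph 7 = graph_of 7 P7_edges"
  "cycle_graph 6 = graph_of 6 C6_edges"
  "Delta1 = graph_of 7 D1_edges"
  "Delta2 = graph_of 7 D2_edges"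
proof -
  have 6: "{..<6::nat} = {0,1,2,3,4,5}" by (auto simp: lessThan_nat_numeral lessThan_Suc)
  have "Suc i < 7 \<longleftrightarrow> i \<in> {..<6}" for i by auto
  then have "{(i, Suc i) | i. Suc i < 7} = (\<lambda>i. (i, Suc i)) ` {..<6}" by (simp only:) blast
  also have "\<dots> = P7_edges"
    unfolding 6 by (simp del: One_nat_def add: One_nat_def[symmetric])
  finally show "path_graph 7 = graph_of 7 P7_edges" by (simp only: path_graph_def)
  have "i < 6 \<longleftrightarrow> i \<in> {..<6}" for i :: nat by simp
  then have "{(i, Suc i mod 6) | i. i < 6} = (\<lambda>i. (i, Suc i mod 6)) ` {..<6}" by (simp only:) blast
  also have "\<dots> = C6_edges"
    unfolding 6 by (simp del: One_nat_def add: One_nat_def[symmetric])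
  finally show "cycle_graph 6 = graph_of 6 C6_edges" by (simp only: cycle_graph_def)
  show "Delta1 = graph_of 7 D1_edges" by (rule Delta1_def)
  show "Delta2 = graph_of 7 D2_edges" by (auto simp: Delta2_def Delta1_def graph_of_def)
qed

lemma not_contains_patterns_iff:
  assumes "graph G"
  shows "\<not> contains_induced G (with_proj (path_graph 7)) \<and>
     \<not> contains_induced G (with_proj (cycle_graph 6)) \<and>
     \<not> contains_induced G (with_proj Delta1) \<and>
     \<not> contains_induced G (with_proj Delta2) \<longleftrightarrow>
     (\<forall>f. \<not> embeds G 7 P7_edges f \<and> \<not> embeds G 6 C6_edges f \<and>
        \<not> embeds G 7 D1_edges f \<and> \<not> embeds G 7 D2_edges f)"
proof -
  have "P7_edges \<subseteq> {..<7} \<times> {..<7}" "C6_edges \<subseteq> {..<6} \<times> {..<6}"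
    "D1_edges \<subseteq> {..<7} \<times> {..<7}" "D2_edges \<subseteq> {..<7} \<times> {..<7}" by auto
  note this[THEN contains_induced_graph_of[OF assms]]
  then show ?thesis unfolding pattern_graph_of by blast
qed

text \<open>Adjacency is restricted to \<open>X\<close>, so that every edge has its ends in
  \<open>X\<close> as the locale demands; a copy of a pattern is still an embedding into
  \<open>G\<close>, because the members of its vertex list all lie in \<open>X\<close>.\<close>

lemma pattern_free_component:
  fixes G :: "('a, 'b) pre_digraph"
  assumes "graph G" "X \<in> pre_digraph.sccs_verts G"
    and free: "\<forall>f. \<not> embeds G 7 P7_edges f \<and> \<not> embeds G 6 C6_edges f \<and>
        \<not> embeds G 7 D1_edges f \<and> \<not> embeds G 7 D2_edges f"
  shows "pattern_free_graph X (\<lambda>u v. u \<in> X \<and> v \<in> X \<and> u \<rightarrow>\<^bsub>G\<^esub> v)" (is "pattern_free_graph X ?E")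
proof -
  interpret graph G by fact
  have XV: "X \<subseteq> verts G" using assms(2) by (rule sccs_verts_subsets)
  have sym: "u \<rightarrow>\<^bsub>G\<^esub> v \<longleftrightarrow> v \<rightarrow>\<^bsub>G\<^esub> u" for u v
    using sym_arcs by (auto simp: symmetric_def sym_def)
  have irr: "\<not> u \<rightarrow>\<^bsub>G\<^esub> u" for u using adj_not_same by blast
  have conn: "?E\<^sup>*\<^sup>* u v" if u: "u \<in> X" and v: "v \<in> X" for u v
  proof -
    have "u \<rightarrow>\<^sup>*\<^bsub>G\<^esub> v" using assms(2) u v by (auto simp: in_sccs_verts_conv_reachable)
    \<comment> \<open>Membership in \<open>X\<close> is carried along: by symmetry every step can be
      undone, so the walk never leaves the component.\<close>
    then have "v \<in> X \<and> ?E\<^sup>*\<^sup>* u v"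
    proof (induction rule: reachable_induct)
      case base then show ?case using u by simp
    next
      case (step v w)
      have "v \<rightarrow>\<^sup>*\<^bsub>G\<^esub> w" "w \<rightarrow>\<^sup>*\<^bsub>G\<^esub> v" using step sym by blast+
      then have "w \<in> X" using step.IH assms(2) by (auto simp: in_sccs_verts_conv_reachable)
      then show ?case using step by (auto intro: rtranclp.rtrancl_into_rtrancl)
    qed
    then show ?thesis ..
  qed
  show ?thesis
  proof unfold_locales
    show "finite X" using XV finite_verts by (rule finite_subset)
    show "?E u v \<Longrightarrow> u \<in> X" for u v by blast
    show "?E u v \<Longrightarrow> ?E v u" for u v using sym by blast
    show "\<not> ?E u u" for u using irr by blast
    show "u \<in> X \<Longrightarrow> v \<in> X \<Longrightarrow> ?E\<^sup>*\<^sup>* u v" for u v by (rule conn)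
  next
    fix v0 v1 v2 v3 v4 v5 v6 :: 'a
    let ?xs = "[v0, v1, v2, v3, v4, v5, v6]"
    assume *: "?E v0 v1" "?E v1 v2" "?E v2 v3" "?E v3 v4" "?E v4 v5" "?E v5 v6"
      "\<not> ?E v0 v2" "\<not> ?E v0 v3" "\<not> ?E v0 v4" "\<not> ?E v0 v5" "\<not> ?E v0 v6"
      "\<not> ?E v1 v3" "\<not> ?E v1 v4" "\<not> ?E v1 v5" "\<not> ?E v1 v6"
      "\<not> ?E v2 v4" "\<not> ?E v2 v5" "\<not> ?E v2 v6" "\<not> ?E v3 v5" "\<not> ?E v3 v6" "\<not> ?E v4 v6"
    have X: "v0 \<in> X" "v1 \<in> X" "v2 \<in> X" "v3 \<in> X" "v4 \<in> X" "v5 \<in> X" "v6 \<in> X" using * by blast+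
    note E = *[unfolded simp_thms X]
    have "embeds G 7 P7_edges (nth ?xs)"
    proof (rule embeds_nth)
      show "distinct ?xs" using E irr sym by auto
      show "\<forall>i<7. \<forall>j<7. ?xs ! i \<rightarrow>\<^bsub>G\<^esub> ?xs ! j \<longleftrightarrow> (i, j) \<in> P7_edges \<or> (j, i) \<in> P7_edges"
        unfolding All_less_7 using E irr sym by simp
    qed (use X XV in auto)
    then show False using free by blast
  next
    fix v0 v1 v2 v3 v4 v5 :: 'a
    let ?xs = "[v0, v1, v2, v3, v4, v5]"
    assume *: "?E v0 v1" "?E v1 v2" "?E v2 v3" "?E v3 v4" "?E v4 v5" "?E v5 v0"
      "\<not> ?E v0 v2" "\<not> ?E v0 v3" "\<not> ?E v0 v4" "\<not> ?E v1 v3" "\<not> ?E v1 v4" "\<not> ?E v1 v5"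
      "\<not> ?E v2 v4" "\<not> ?E v2 v5" "\<not> ?E v3 v5"
    have X: "v0 \<in> X" "v1 \<in> X" "v2 \<in> X" "v3 \<in> X" "v4 \<in> X" "v5 \<in> X" using * by blast+
    note E = *[unfolded simp_thms X]
    have "embeds G 6 C6_edges (nth ?xs)"
    proof (rule embeds_nth)
      show "distinct ?xs" using E irr sym by auto
      show "\<forall>i<6. \<forall>j<6. ?xs ! i \<rightarrow>\<^bsub>G\<^esub> ?xs ! j \<longleftrightarrow> (i, j) \<in> C6_edges \<or> (j, i) \<in> C6_edges"
        unfolding All_less_6 using E irr sym by simp
    qed (use X XV in auto)
    then show False using free by blast
  next
    fix a1 a3 b1 b3 c a2 b2 :: 'a
    let ?xs = "[c, a1, a2, a3, b1, b2, b3]"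
    assume *: "a1 \<noteq> a3" "b1 \<noteq> b3" "?E c a1" "?E a1 a2" "?E a2 a3" "?E a3 c"
      "?E c b1" "?E b1 b2" "?E b2 b3" "?E b3 c" "\<not> ?E c a2" "\<not> ?E c b2" "\<not> ?E a1 a3" "\<not> ?E b1 b3"
      "\<not> ?E a1 b1" "\<not> ?E a1 b2" "\<not> ?E a1 b3" "\<not> ?E a2 b1" "\<not> ?E a2 b2" "\<not> ?E a2 b3"
      "\<not> ?E a3 b1" "\<not> ?E a3 b2" "\<not> ?E a3 b3"
    have X: "c \<in> X" "a1 \<in> X" "a2 \<in> X" "a3 \<in> X" "b1 \<in> X" "b2 \<in> X" "b3 \<in> X" using * by blast+
    note E = *[unfolded simp_thms X]
    have "embeds G 7 D1_edges (nth ?xs)"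
    proof (rule embeds_nth)
      show "distinct ?xs" using E irr sym by auto
      show "\<forall>i<7. \<forall>j<7. ?xs ! i \<rightarrow>\<^bsub>G\<^esub> ?xs ! j \<longleftrightarrow> (i, j) \<in> D1_edges \<or> (j, i) \<in> D1_edges"
        unfolding All_less_7 using E irr sym by simp
    qed (use X XV in auto)
    then show False using free by blast
  next
    fix b1 b3 a1 a2 a3 c b2 :: 'a
    let ?xs = "[c, a1, a2, a3, b1, b2, b3]"
    assume *: "b1 \<noteq> b3" "?E a1 a2" "?E a2 a3" "?E a3 c"
      "?E c b1" "?E b1 b2" "?E b2 b3" "?E b3 c" "\<not> ?E c a1" "\<not> ?E c a2" "\<not> ?E c b2"
      "\<not> ?E a1 a3" "\<not> ?E b1 b3"
      "\<not> ?E a1 b1" "\<not> ?E a1 b2" "\<not> ?E a1 b3" "\<not> ?E a2 b1" "\<not> ?E a2 b2" "\<not> ?E a2 b3"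
      "\<not> ?E a3 b1" "\<not> ?E a3 b2" "\<not> ?E a3 b3"
    have X: "c \<in> X" "a1 \<in> X" "a2 \<in> X" "a3 \<in> X" "b1 \<in> X" "b2 \<in> X" "b3 \<in> X" using * by blast+
    note E = *[unfolded simp_thms X]
    have "embeds G 7 D2_edges (nth ?xs)"
    proof (rule embeds_nth)
      show "distinct ?xs" using E irr sym by auto
      show "\<forall>i<7. \<forall>j<7. ?xs ! i \<rightarrow>\<^bsub>G\<^esub> ?xs ! j \<longleftrightarrow> (i, j) \<in> D2_edges \<or> (j, i) \<in> D2_edges"
        unfolding All_less_7 using E irr sym by simp
    qed (use X XV in auto)
    then show False using free by blast
  qed
qed

section \<open>The patterns violate the bound\<close>

text \<open>In this form connectedness moves along an embedding by moving the set \<open>A\<close>,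
  and a single \<open>A\<close> refutes it. The set reachable from a vertex gives the direction back
  to strong connectedness.\<close>

lemma (in sym_digraph) connected_iff_cut:
  "connected G \<longleftrightarrow> verts G \<noteq> {} \<and>
     (\<forall>A. (\<forall>u v. u \<rightarrow>\<^bsub>G\<^esub> v \<longrightarrow> (u \<in> A \<longleftrightarrow> v \<in> A)) \<longrightarrow> verts G \<subseteq> A \<or> verts G \<inter> A = {})"
proof -
  have sym: "(arcs_ends G)\<^sup>s = arcs_ends G"
    using sym_arcs by (auto simp: symmetric_def symcl_def sym_def)
  have "connected G \<longleftrightarrow> strongly_connected G"
    unfolding connected_conv strongly_connected_def reachable_def sym ..
  also have "\<dots> \<longleftrightarrow> verts G \<noteq> {} \<and>
     (\<forall>A. (\<forall>u v. u \<rightarrow>\<^bsub>G\<^esub> v \<longrightarrow> (u \<in> A \<longleftrightarrow> v \<in> A)) \<longrightarrow> verts G \<subseteq> A \<or> verts G \<inter> A = {})"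
  proof (intro iffI conjI allI impI)
    fix A assume sc: "strongly_connected G" and A: "\<forall>u v. u \<rightarrow>\<^bsub>G\<^esub> v \<longrightarrow> (u \<in> A \<longleftrightarrow> v \<in> A)"
    have "v \<in> A" if "u \<in> A" "u \<in> verts G" "v \<in> verts G" for u v
    proof -
      have "u \<rightarrow>\<^sup>*\<^bsub>G\<^esub> v" using sc that by (simp add: strongly_connected_def)
      then show ?thesis by (induction rule: reachable_induct) (use A that in blast)+
    qed
    then show "verts G \<subseteq> A \<or> verts G \<inter> A = {}" by blast
  next
    assume *: "verts G \<noteq> {} \<and>
      (\<forall>A. (\<forall>u v. u \<rightarrow>\<^bsub>G\<^esub> v \<longrightarrow> (u \<in> A \<longleftrightarrow> v \<in> A)) \<longrightarrow> verts G \<subseteq> A \<or> verts G \<inter> A = {})"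
    have "u \<rightarrow>\<^sup>*\<^bsub>G\<^esub> v" if "u \<in> verts G" "v \<in> verts G" for u v
    proof -
      let ?A = "{w. u \<rightarrow>\<^sup>*\<^bsub>G\<^esub> w}"
      have "v \<rightarrow>\<^bsub>G\<^esub> u" if "u \<rightarrow>\<^bsub>G\<^esub> v" for u v using that sym_arcs by (auto simp: symmetric_def sym_def)
      then have "\<forall>a b. a \<rightarrow>\<^bsub>G\<^esub> b \<longrightarrow> (a \<in> ?A \<longleftrightarrow> b \<in> ?A)"
        using reachable_adj_trans by blast
      then have "verts G \<subseteq> ?A \<or> verts G \<inter> ?A = {}" using * by blast
      moreover have "u \<in> ?A" using that by simp
      ultimately show ?thesis using that by blast
    qed
    then show "strongly_connected G" using * by (simp add: strongly_connected_def)
  qed (simp add: strongly_connected_def)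
  finally show ?thesis .
qed

lemma vertex_cover_iff:
  "vertex_cover G C \<longleftrightarrow> C \<subseteq> verts G \<and> (\<forall>u v. u \<rightarrow>\<^bsub>G\<^esub> v \<longrightarrow> u \<in> C \<or> v \<in> C)"
  unfolding vertex_cover_def arcs_ends_conv by auto

definition covers :: "nat rel \<Rightarrow> nat set \<Rightarrow> bool" where
  "covers F T \<longleftrightarrow> (\<forall>(a, b) \<in> F. a \<in> T \<or> b \<in> T)"

text \<open>\<open>T\<close> is empty or induces a connected subgraph of the pattern, in cut form;
  the equivalence makes the direction of the pairs in \<open>F\<close> irrelevant.\<close>

definition linked :: "nat rel \<Rightarrow> nat set \<Rightarrow> bool" where
  "linked F T \<longleftrightarrow> (\<forall>A. (\<forall>(a, b) \<in> F. a \<in> T \<longrightarrow> b \<in> T \<longrightarrow> (a \<in> A \<longleftrightarrow> b \<in> A)) \<longrightarrow>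
     T \<subseteq> A \<or> T \<inter> A = {})"

lemma linkedD:
  assumes "linked F T" "\<forall>(a, b) \<in> F. a \<in> T \<longrightarrow> b \<in> T \<longrightarrow> (a \<in> A \<longleftrightarrow> b \<in> A)" "i \<in> T" "j \<in> T" "i \<in> A"
  shows "j \<in> A"
  using assms unfolding linked_def by blast

text \<open>The constants fit because 3/2 times 3 is less than 5. Covers and cuts are pulled back
  along \<open>f\<close>, so only the pattern on \<open>{..<n}\<close> has to be examined.\<close>

lemma embeds_bad_ratio:
  fixes G :: "('a, 'b) pre_digraph"
  assumes "graph G" and f: "embeds G n F f" and F: "F \<subseteq> {..<n} \<times> {..<n}" "F \<noteq> {}"
    and link: "linked F {..<n}" and K: "covers F K" "K \<subseteq> {..<n}" "card K \<le> 3"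
    and lower: "\<And>T. T \<subseteq> {..<n} \<Longrightarrow> covers F T \<Longrightarrow> linked F T \<Longrightarrow> 5 \<le> card T"
  shows "\<exists>H. induced_subgraph H G \<and> \<not> real (cvc_number H) \<le> 3 / 2 * real (vc_number H)"
proof -
  interpret graph G by fact
  have inj: "inj_on f {..<n}" and fV: "f ` {..<n} \<subseteq> verts G"
    and adj: "\<And>i j. i < n \<Longrightarrow> j < n \<Longrightarrow> f i \<rightarrow>\<^bsub>G\<^esub> f j \<longleftrightarrow> (i, j) \<in> F \<or> (j, i) \<in> F"
    using f unfolding embeds_def by blast+
  define W where "W = f ` {..<n}"
  define H where "H = G \<restriction> W"
  have ind: "induced_subgraph H G" unfolding H_def W_def using fV by (rule induced_induce)
  have gH: "graph H" using assms(1) ind by (rule graph_induced_subgraph)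
  interpret H: graph H by (rule gH)
  have vH: "verts H = W" by (simp add: H_def)
  have dH: "u \<rightarrow>\<^bsub>H\<^esub> v \<longleftrightarrow> u \<in> W \<and> v \<in> W \<and> u \<rightarrow>\<^bsub>G\<^esub> v" for u v
    using dominates_induced[OF ind] unfolding vH .
  have dHf: "f i \<rightarrow>\<^bsub>H\<^esub> f j \<longleftrightarrow> (i, j) \<in> F \<or> (j, i) \<in> F" if "i < n" "j < n" for i j
    using adj[OF that] dH that by (auto simp: W_def)
  have Fn: "a < n" "b < n" if "(a, b) \<in> F" for a b using F that by auto
  define tr where "tr C = {i. i < n \<and> f i \<in> C}" for C
  have card_tr: "card (tr C) = card C" if "C \<subseteq> W" for C
  proof -
    have "C = f ` tr C" using that by (auto simp: tr_def W_def)
    moreover have "inj_on f (tr C)" using inj by (rule inj_on_subset) (auto simp: tr_def)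
    ultimately show ?thesis by (metis card_image)
  qed
  have cov: "covers F (tr C)" if "vertex_cover H C" for C
    using that dHf Fn unfolding vertex_cover_iff covers_def tr_def by blast
  have "vertex_cover H (f ` K)"
    unfolding vertex_cover_iff vH
  proof (intro conjI allI impI)
    show "f ` K \<subseteq> W" using K by (auto simp: W_def)
    fix u v assume uv: "u \<rightarrow>\<^bsub>H\<^esub> v"
    then obtain i j where ij: "u = f i" "v = f j" "i < n" "j < n" using dH by (auto simp: W_def)
    then have "i \<in> K \<or> j \<in> K" using K(1) dHf uv unfolding covers_def by blast
    then show "u \<in> f ` K \<or> v \<in> f ` K" using ij by blast
  qed
  then have "vc_number H \<le> card (f ` K)" unfolding vc_number_def by (intro Least_le) blast
  also have "\<dots> \<le> 3" using card_image_le[of K f] K finite_subset[OF K(2)] by simp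
  finally have covering: "vc_number H \<le> 3" .
  obtain a b where ab: "(a, b) \<in> F" using F by auto
  have conH: "connected H"
    unfolding H.connected_iff_cut vH
  proof (intro conjI allI impI)
    show "W \<noteq> {}" using Fn[OF ab] by (auto simp: W_def)
    fix A assume A: "\<forall>u v. u \<rightarrow>\<^bsub>H\<^esub> v \<longrightarrow> (u \<in> A \<longleftrightarrow> v \<in> A)"
    have "\<forall>(a, b) \<in> F. a \<in> {..<n} \<longrightarrow> b \<in> {..<n} \<longrightarrow> (a \<in> tr A \<longleftrightarrow> b \<in> tr A)"
      using A dHf Fn unfolding tr_def by blast
    then have "{..<n} \<subseteq> tr A \<or> {..<n} \<inter> tr A = {}" using link unfolding linked_def by blast
    then show "W \<subseteq> A \<or> W \<inter> A = {}" by (auto simp: W_def tr_def)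
  qed
  have arcsH: "arcs H \<noteq> {}"
    using dHf[OF Fn[OF ab]] ab unfolding arcs_ends_conv by auto
  note cvc_iff = connected_vertex_cover_connected_iff[OF gH conH arcsH]
  \<comment> \<open>Some connected cover must exist before the \<open>LEAST\<close> in
    \<open>cvc_number\<close> can be taken to be attained.\<close>
  have "connected_vertex_cover H (verts H)"
  proof -
    have "H \<restriction> verts H = H"
      unfolding induce_subgraph_def using H.wellformed by (auto intro: pre_digraph.equality)
    then show ?thesis
      unfolding cvc_iff using conH H.head_in_verts by (simp add: vertex_cover_def)
  qed
  then have "\<exists>k C. connected_vertex_cover H C \<and> card C = k" by blast
  from LeastI_ex[OF this] obtain C where C: "connected_vertex_cover H C" "card C = cvc_number H"
    unfolding cvc_number_def[symmetric] by blast
  then have CW: "C \<subseteq> W" and vcC: "vertex_cover H C" and conC: "connected (H \<restriction> C)"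
    unfolding cvc_iff by (auto simp: vertex_cover_def vH)
  interpret C: sym_digraph "H \<restriction> C" using gH CW vH by (intro sym_digraph_induce) auto
  have "linked F (tr C)"
    unfolding linked_def
  proof (intro allI impI)
    fix A assume A: "\<forall>(a, b) \<in> F. a \<in> tr C \<longrightarrow> b \<in> tr C \<longrightarrow> (a \<in> A \<longleftrightarrow> b \<in> A)"
    let ?A = "f ` (A \<inter> {..<n})"
    have fA: "f i \<in> ?A \<longleftrightarrow> i \<in> A" if "i < n" for i
      using inj that by (auto dest: inj_onD)
    have "u \<in> ?A \<longleftrightarrow> v \<in> ?A" if "u \<rightarrow>\<^bsub>H \<restriction> C\<^esub> v" for u v
    proof -
      have uv: "u \<in> C" "v \<in> C" "u \<rightarrow>\<^bsub>H\<^esub> v" using that by auto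
      then obtain i j where ij: "u = f i" "v = f j" "i < n" "j < n"
        using CW unfolding W_def by blast
      then have "i \<in> tr C" "j \<in> tr C" "(i, j) \<in> F \<or> (j, i) \<in> F"
        using uv dHf[of i j] by (simp_all add: tr_def)
      then have "i \<in> A \<longleftrightarrow> j \<in> A" using A by blast
      then show ?thesis using fA ij by simp
    qed
    then have "C \<subseteq> ?A \<or> C \<inter> ?A = {}" using conC unfolding C.connected_iff_cut by simp
    then show "tr C \<subseteq> A \<or> tr C \<inter> A = {}" using fA unfolding tr_def by blast
  qed
  then have "5 \<le> card (tr C)" using cov[OF vcC] by (intro lower) (auto simp: tr_def)
  then have "5 \<le> cvc_number H" using C(2) card_tr[OF CW] by simp
  then have "\<not> real (cvc_number H) \<le> 3 / 2 * real (vc_number H)" using covering by linarith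
  then show ?thesis using ind by blast
qed

lemma linkedI:
  assumes "i \<in> T" "\<And>A. \<forall>(a, b) \<in> F. a \<in> T \<longrightarrow> b \<in> T \<longrightarrow> (a \<in> A \<longleftrightarrow> b \<in> A) \<Longrightarrow> \<forall>j\<in>T. j \<in> A \<longleftrightarrow> i \<in> A"
  shows "linked F T"
  unfolding linked_def using assms by (meson disjoint_iff subsetI)

lemma linked_patterns:
  "linked P7_edges {..<7}" "linked C6_edges {..<6}" "linked D1_edges {..<7}" "linked D2_edges {..<7}"
proof -
  have 6: "{..<6::nat} = {0,1,2,3,4,5}" by (auto simp: lessThan_nat_numeral lessThan_Suc)
  have 7: "{..<7::nat} = {0,1,2,3,4,5,6}" by (auto simp: lessThan_nat_numeral lessThan_Suc)
  show "linked P7_edges {..<7}" "linked C6_edges {..<6}" "linked D1_edges {..<7}" "linked D2_edges {..<7}"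
    unfolding 6 7
    by (rule linkedI[of 0]; (simp (no_asm_use) only: ball_simps prod.case insert_iff simp_thms; blast))+
qed

section \<open>Five vertices in every connected cover of a pattern\<close>

lemma card_ge_5:
  fixes T :: "nat set"
  assumes "T \<subseteq> {..<n}" "S \<subseteq> T" "card S = 5"
  shows "5 \<le> card T"
proof -
  have "finite T" using assms(1) by (rule finite_subset) simp
  then show ?thesis using card_mono[of T S] assms by simp
qed

text \<open>A missing inner vertex forces both its neighbours into the cover, and these lie on
  different sides of it. So all five inner vertices belong to \<open>T\<close>.\<close>

lemma P7_lower:
  assumes T: "T \<subseteq> {..<7}" and c: "covers P7_edges T" and l: "linked P7_edges T"
  shows "5 \<le> card T"
proof -
  have c: "0 \<in> T \<or> 1 \<in> T" "1 \<in> T \<or> 2 \<in> T" "2 \<in> T \<or> 3 \<in> T" "3 \<in> T \<or> 4 \<in> T" "4 \<in> T \<or> 5 \<in> T"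
    "5 \<in> T \<or> 6 \<in> T"
    using c by (simp_all add: covers_def)
  have no2: False if A: "\<forall>(a, b) \<in> P7_edges. a \<in> T \<longrightarrow> b \<in> T \<longrightarrow> (a \<in> A \<longleftrightarrow> b \<in> A)"
    "i \<in> T" "i \<in> A" "j \<in> T" "j \<notin> A" for A i j
    using linkedD[OF l A(1,2,4,3)] A(5) by blast
  have "1 \<in> T"
    by (rule ccontr, rule no2[of "{0}" 0 2]) (use c in auto)
  moreover have "2 \<in> T"
    by (rule ccontr, rule no2[of "{0,1}" 1 3]) (use c in auto)
  moreover have "3 \<in> T"
    by (rule ccontr, rule no2[of "{0,1,2}" 2 4]) (use c in auto)
  moreover have "4 \<in> T"
    by (rule ccontr, rule no2[of "{0,1,2,3}" 3 5]) (use c in auto)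
  moreover have "5 \<in> T"
    by (rule ccontr, rule no2[of "{0,1,2,3,4}" 4 6]) (use c in auto)
  ultimately show ?thesis by (intro card_ge_5[OF T, of "{1,2,3,4,5}"]) auto
qed

text \<open>Two missing vertices would separate the cycle into two arcs.\<close>
lemma C6_lower:
  assumes T: "T \<subseteq> {..<6}" and c: "covers C6_edges T" and l: "linked C6_edges T"
  shows "5 \<le> card T"
proof -
  have c: "0 \<in> T \<or> 1 \<in> T" "1 \<in> T \<or> 2 \<in> T" "2 \<in> T \<or> 3 \<in> T" "3 \<in> T \<or> 4 \<in> T" "4 \<in> T \<or> 5 \<in> T"
    "5 \<in> T \<or> 0 \<in> T"
    using c by (simp_all add: covers_def)
  have no2: False if A: "\<forall>(a, b) \<in> C6_edges. a \<in> T \<longrightarrow> b \<in> T \<longrightarrow> (a \<in> A \<longleftrightarrow> b \<in> A)"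
    "i \<in> T" "i \<in> A" "j \<in> T" "j \<notin> A" for A i j
    using linkedD[OF l A(1,2,4,3)] A(5) by blast
  have p0: "0 \<in> T \<or> 2 \<in> T"
    by (rule ccontr, rule no2[of "{1}" 1 3]) (use c in auto)
  have p1: "0 \<in> T \<or> 3 \<in> T"
    by (rule ccontr, rule no2[of "{1,2}" 1 4]) (use c in auto)
  have p2: "0 \<in> T \<or> 4 \<in> T"
    by (rule ccontr, rule no2[of "{1,2,3}" 1 5]) (use c in auto)
  have p3: "1 \<in> T \<or> 3 \<in> T"
    by (rule ccontr, rule no2[of "{2}" 2 0]) (use c in auto)
  have p4: "1 \<in> T \<or> 4 \<in> T"
    by (rule ccontr, rule no2[of "{2,3}" 2 0]) (use c in auto)
  have p5: "1 \<in> T \<or> 5 \<in> T"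
    by (rule ccontr, rule no2[of "{2,3,4}" 2 0]) (use c in auto)
  have p6: "2 \<in> T \<or> 4 \<in> T"
    by (rule ccontr, rule no2[of "{3}" 3 1]) (use c in auto)
  have p7: "2 \<in> T \<or> 5 \<in> T"
    by (rule ccontr, rule no2[of "{3,4}" 3 1]) (use c in auto)
  have p8: "3 \<in> T \<or> 5 \<in> T"
    by (rule ccontr, rule no2[of "{4}" 4 2]) (use c in auto)
  note pair = p0 p1 p2 p3 p4 p5 p6 p7 p8
  have "\<exists>i\<in>{0,1,2,3,4,5}. {0,1,2,3,4,5} - {i} \<subseteq> T"
  proof (cases "{0,1,2,3,4,5} \<subseteq> T")
    case False
    then obtain i where i: "i \<in> {0,1,2,3,4,5}" "i \<notin> T" by blast
    from i(1) have "{0,1,2,3,4,5} - {i} \<subseteq> T"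
      by (elim insertE emptyE) (use i(2) c pair in auto)
    then show ?thesis using i(1) by blast
  qed auto
  then obtain i where i: "i \<in> {0,1,2,3,4,5}" "{0,1,2,3,4,5} - {i} \<subseteq> T" by blast
  have "card ({0,1,2,3,4,5} - {i}) = 5"
    using i(1) by (subst card_Diff_singleton) auto
  with i(2) show ?thesis by (rule card_ge_5[OF T])
qed

text \<open>Omitting the cut vertex 0 would force its neighbours on both sides into
  \<open>T\<close>. Each 4-cycle then contributes two more vertices: covering the edges off 0 needs
  the vertex opposite 0 or both neighbours of that vertex, and the opposite one alone would be cut
  off from 0.\<close>

lemma D1_lower:
  assumes T: "T \<subseteq> {..<7}" and c: "covers D1_edges T" and l: "linked D1_edges T"
  shows "5 \<le> card T"
proof -
  have c: "0 \<in> T \<or> 1 \<in> T" "1 \<in> T \<or> 2 \<in> T" "2 \<in> T \<or> 3 \<in> T" "3 \<in> T \<or> 0 \<in> T" "0 \<in> T \<or> 4 \<in> T"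
    "4 \<in> T \<or> 5 \<in> T" "5 \<in> T \<or> 6 \<in> T" "6 \<in> T \<or> 0 \<in> T"
    using c by (simp_all add: covers_def)
  have no2: False if A: "\<forall>(a, b) \<in> D1_edges. a \<in> T \<longrightarrow> b \<in> T \<longrightarrow> (a \<in> A \<longleftrightarrow> b \<in> A)"
    "i \<in> T" "i \<in> A" "j \<in> T" "j \<notin> A" for A i j
    using linkedD[OF l A(1,2,4,3)] A(5) by blast
  have 0: "0 \<in> T"
    by (rule ccontr, rule no2[of "{1,2,3}" 1 4]) (use c in auto)
  have a: "2 \<notin> T \<or> 1 \<in> T \<or> 3 \<in> T"
    by (rule ccontr, rule no2[of "{2}" 2 0]) (use 0 in auto)
  have b: "5 \<notin> T \<or> 4 \<in> T \<or> 6 \<in> T"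
    by (rule ccontr, rule no2[of "{5}" 5 0]) (use 0 in auto)
  have "\<exists>S\<in>{{1,2},{1,3},{2,3}}. S \<subseteq> T" using c a by auto
  moreover have "\<exists>S\<in>{{4,5},{4,6},{5,6}}. S \<subseteq> T" using c b by auto
  ultimately obtain P Q where PQ: "P \<in> {{1,2},{1,3},{2,3}}" "Q \<in> {{4,5},{4,6},{5,6}}"
    "P \<subseteq> T" "Q \<subseteq> T" by metis
  show ?thesis
  proof (rule card_ge_5[OF T])
    show "insert 0 (P \<union> Q) \<subseteq> T" using 0 PQ by blast
    show "card (insert 0 (P \<union> Q)) = 5"
      using PQ(1,2) by (elim insertE emptyE) simp_all
  qed
qed

text \<open>2, 3 and 0 are cut vertices along the pendant path, and each is forced as an inner
  vertex of a path is; the 4-cycle contributes two more vertices as in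
  \<open>Delta1\<close>.\<close>

lemma D2_lower:
  assumes T: "T \<subseteq> {..<7}" and c: "covers D2_edges T" and l: "linked D2_edges T"
  shows "5 \<le> card T"
proof -
  have c: "1 \<in> T \<or> 2 \<in> T" "2 \<in> T \<or> 3 \<in> T" "3 \<in> T \<or> 0 \<in> T" "0 \<in> T \<or> 4 \<in> T"
    "4 \<in> T \<or> 5 \<in> T" "5 \<in> T \<or> 6 \<in> T" "6 \<in> T \<or> 0 \<in> T"
    using c by (simp_all add: covers_def)
  have no2: False if A: "\<forall>(a, b) \<in> D2_edges. a \<in> T \<longrightarrow> b \<in> T \<longrightarrow> (a \<in> A \<longleftrightarrow> b \<in> A)"
    "i \<in> T" "i \<in> A" "j \<in> T" "j \<notin> A" for A i j
    using linkedD[OF l A(1,2,4,3)] A(5) by blast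
  have 2: "2 \<in> T"
    by (rule ccontr, rule no2[of "{1}" 1 3]) (use c in auto)
  have 3: "3 \<in> T"
    by (rule ccontr, rule no2[of "{1,2}" 2 0]) (use c 2 in auto)
  have 0: "0 \<in> T"
    by (rule ccontr, rule no2[of "{1,2,3}" 3 4]) (use c 3 in auto)
  have b: "5 \<notin> T \<or> 4 \<in> T \<or> 6 \<in> T"
    by (rule ccontr, rule no2[of "{5}" 5 0]) (use 0 in auto)
  have "\<exists>S\<in>{{4,5},{4,6},{5,6}}. S \<subseteq> T" using c b by auto
  then obtain Q where Q: "Q \<in> {{4,5},{4,6},{5,6}}" "Q \<subseteq> T" by metis
  show ?thesis
  proof (rule card_ge_5[OF T])
    show "{0,2,3} \<union> Q \<subseteq> T" using 0 2 3 Q by blast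
    show "card ({0,2,3} \<union> Q) = 5"
      using Q(1) by (elim insertE emptyE) simp_all
  qed
qed

section \<open>Assembling the components\<close>

text \<open>\<open>reach\<close> is reflexive everywhere, whereas reachability in
  \<open>G \<restriction> T\<close> needs vertices of \<open>T\<close>; hence the membership of
  \<open>u\<close>. The larger set \<open>T\<close> lets the connections of one component be used
  inside the union of all local covers.\<close>

lemma reach_induce:
  assumes "reach E S u v" "u \<in> S" "\<And>a b. E a b \<Longrightarrow> a \<rightarrow>\<^bsub>G\<^esub> b" "S \<subseteq> T"
  shows "u \<rightarrow>\<^sup>*\<^bsub>G \<restriction> T\<^esub> v"
  using assms(1) unfolding reach_def
proof (induction rule: rtranclp_induct)
  case base
  then show ?case using assms(2,4) by (auto simp: reachable_def)
next
  case (step v w)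
  then have "v \<rightarrow>\<^bsub>G \<restriction> T\<^esub> w" using assms(3,4) by auto
  then show ?case
    using step.IH step.hyps(2) assms(4) unfolding reachable_def
    by (auto intro: rtrancl_on_into_rtrancl_on)
qed

text \<open>A minimum cover \<open>C\<close> is treated component by component:
  \<open>C \<inter> X\<close> covers \<open>X\<close>, and the local bounds add up because
  components are disjoint.\<close>

lemma cvc_number_le:
  fixes G :: "('a, 'b) pre_digraph"
  assumes "graph G"
    and free: "\<forall>f. \<not> embeds G 7 P7_edges f \<and> \<not> embeds G 6 C6_edges f \<and>
        \<not> embeds G 7 D1_edges f \<and> \<not> embeds G 7 D2_edges f"
  shows "2 * cvc_number G \<le> 3 * vc_number G"
proof -
  interpret graph G by fact
  have sym: "v \<rightarrow>\<^bsub>G\<^esub> u" if "u \<rightarrow>\<^bsub>G\<^esub> v" for u v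
    using that sym_arcs by (auto simp: symmetric_def sym_def)
  have "vertex_cover G (verts G)" by (auto simp: vertex_cover_def)
  then have "\<exists>k C. vertex_cover G C \<and> card C = k" by blast
  from LeastI_ex[OF this] obtain C where C: "vertex_cover G C" "card C = vc_number G"
    unfolding vc_number_def[symmetric] by blast
  have CV: "C \<subseteq> verts G" using C(1) by (simp add: vertex_cover_def)
  have fC: "finite C" using CV finite_verts by (rule finite_subset)
  \<comment> \<open>Exactly the components that \<open>connected_vertex_cover\<close> counts;
    isolated vertices of \<open>G\<close> receive nothing.\<close>
  define Q where "Q = {X \<in> sccs_verts. \<exists>u\<in>X. \<exists>v\<in>X. u \<rightarrow>\<^bsub>G\<^esub> v}"
  have fQ: "finite Q" unfolding Q_def using finite_sccs_verts by simp
  have disj: "X = Y" if "X \<in> Q" "Y \<in> Q" "u \<in> X" "u \<in> Y" for X Y u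
    using that sccs_verts_disjoint[of X Y] by (auto simp: Q_def)
  have "\<forall>X\<in>Q. \<exists>S\<subseteq>X. S \<noteq> {} \<and> 2 * card S \<le> 3 * card (C \<inter> X) \<and>
      (\<forall>u\<in>X. \<forall>v\<in>X. u \<rightarrow>\<^bsub>G\<^esub> v \<longrightarrow> u \<in> S \<or> v \<in> S) \<and>
      (\<forall>u\<in>S. \<forall>v\<in>S. \<forall>T. S \<subseteq> T \<longrightarrow> u \<rightarrow>\<^sup>*\<^bsub>G \<restriction> T\<^esub> v)"
  proof
    fix X assume X: "X \<in> Q"
    let ?E = "\<lambda>u v. u \<in> X \<and> v \<in> X \<and> u \<rightarrow>\<^bsub>G\<^esub> v"
    interpret X: pattern_free_graph X ?E
      using pattern_free_component[OF assms(1) _ free] X by (simp add: Q_def)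
    have "X.covering (C \<inter> X)"
      using C(1) unfolding X.covering_def vertex_cover_iff by blast
    moreover obtain a b where "?E a b" using X by (auto simp: Q_def)
    ultimately obtain S where S: "X.covering S" "S \<noteq> {}" "2 * card S \<le> 3 * card (C \<inter> X)"
      "\<forall>u\<in>S. \<forall>v\<in>S. reach ?E S u v"
      using X.connected_cover_exists[of "C \<inter> X" a b] by blast
    have "u \<rightarrow>\<^sup>*\<^bsub>G \<restriction> T\<^esub> v" if "u \<in> S" "v \<in> S" "S \<subseteq> T" for u v T
      by (rule reach_induce[of ?E S]) (use S(4) that in auto)
    moreover have "S \<subseteq> X" "\<forall>u\<in>X. \<forall>v\<in>X. u \<rightarrow>\<^bsub>G\<^esub> v \<longrightarrow> u \<in> S \<or> v \<in> S"
      using S(1) unfolding X.covering_def by blast+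
    ultimately show "\<exists>S\<subseteq>X. S \<noteq> {} \<and> 2 * card S \<le> 3 * card (C \<inter> X) \<and>
      (\<forall>u\<in>X. \<forall>v\<in>X. u \<rightarrow>\<^bsub>G\<^esub> v \<longrightarrow> u \<in> S \<or> v \<in> S) \<and>
      (\<forall>u\<in>S. \<forall>v\<in>S. \<forall>T. S \<subseteq> T \<longrightarrow> u \<rightarrow>\<^sup>*\<^bsub>G \<restriction> T\<^esub> v)"
      using S(2,3) by (intro exI[of _ S]) simp
  qed
  from bchoice[OF this] obtain S where S': "\<forall>X\<in>Q. S X \<subseteq> X \<and> S X \<noteq> {} \<and>
      2 * card (S X) \<le> 3 * card (C \<inter> X) \<and>
      (\<forall>u\<in>X. \<forall>v\<in>X. u \<rightarrow>\<^bsub>G\<^esub> v \<longrightarrow> u \<in> S X \<or> v \<in> S X) \<and>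
      (\<forall>u\<in>S X. \<forall>v\<in>S X. \<forall>T. S X \<subseteq> T \<longrightarrow> u \<rightarrow>\<^sup>*\<^bsub>G \<restriction> T\<^esub> v)" ..
  have S: "S X \<subseteq> X" "S X \<noteq> {}" "2 * card (S X) \<le> 3 * card (C \<inter> X)"
      "\<And>u v. u \<in> X \<Longrightarrow> v \<in> X \<Longrightarrow> u \<rightarrow>\<^bsub>G\<^esub> v \<Longrightarrow> u \<in> S X \<or> v \<in> S X"
      "\<And>u v T. u \<in> S X \<Longrightarrow> v \<in> S X \<Longrightarrow> S X \<subseteq> T \<Longrightarrow> u \<rightarrow>\<^sup>*\<^bsub>G \<restriction> T\<^esub> v"
    if "X \<in> Q" for X using bspec[OF S' that] by blast+
  define D where "D = (\<Union>X\<in>Q. S X)"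
  have QV: "X \<subseteq> verts G" if "X \<in> Q" for X
    using that sccs_verts_subsets by (simp add: Q_def)
  have DV: "D \<subseteq> verts G" unfolding D_def using S(1) QV by blast
  have "vertex_cover G D"
    unfolding vertex_cover_iff
  proof (intro conjI allI impI)
    fix u v assume uv: "u \<rightarrow>\<^bsub>G\<^esub> v"
    have u: "u \<in> verts G" using uv by (auto intro: adj_in_verts)
    have "u \<rightarrow>\<^sup>*\<^bsub>G\<^esub> v" "v \<rightarrow>\<^sup>*\<^bsub>G\<^esub> u" using uv sym by blast+
    then have "v \<in> scc_of u" by (simp add: scc_of_def)
    moreover have "u \<in> scc_of u" using u by (rule in_scc_of_self)
    moreover have "scc_of u \<in> sccs_verts" using u by (rule scc_of_in_sccs_verts)
    ultimately have "scc_of u \<in> Q" "u \<in> scc_of u" "v \<in> scc_of u" using uv by (auto simp: Q_def)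
    then show "u \<in> D \<or> v \<in> D" using S(4) uv unfolding D_def by blast
  qed (rule DV)
  moreover have "card (pre_digraph.sccs (G \<restriction> D)) = card {K \<in> sccs. arcs K \<noteq> {}}"
  proof -
    interpret D: wf_digraph "G \<restriction> D" by (rule wellformed_induce_subgraph)
    \<comment> \<open>\<open>S X\<close> is connected inside \<open>D\<close>, and reachability in
      \<open>D\<close> cannot leave the component \<open>X\<close> of \<open>G\<close>, where
      \<open>D\<close> has only \<open>S X\<close>.\<close>
    have scc: "D.scc_of u = S X" if X: "X \<in> Q" "u \<in> S X" for X u
    proof (intro set_eqI iffI)
      fix v assume "v \<in> S X"
      moreover have "S X \<subseteq> D" using X by (auto simp: D_def)
      ultimately show "v \<in> D.scc_of u" using S(5)[OF X(1)] X by (simp add: D.scc_of_def)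
    next
      fix v assume v: "v \<in> D.scc_of u"
      then have uv: "u \<rightarrow>\<^sup>*\<^bsub>G \<restriction> D\<^esub> v" "v \<rightarrow>\<^sup>*\<^bsub>G \<restriction> D\<^esub> u" by (auto simp: D.scc_of_def)
      then have "v \<in> D" using D.reachable_in_verts(2)[OF uv(1)] by simp
      then obtain Y where Y: "Y \<in> Q" "v \<in> S Y" by (auto simp: D_def)
      have "u \<rightarrow>\<^sup>*\<^bsub>G\<^esub> v" "v \<rightarrow>\<^sup>*\<^bsub>G\<^esub> u" using reachable_induce_subgraphD[OF _ DV] uv by blast+
      moreover have "u \<in> X" using S(1) X by blast
      ultimately have "v \<in> X" using X by (auto simp: Q_def in_sccs_verts_conv_reachable)
      then have "X = Y" using disj[OF X(1) Y(1)] S(1)[OF Y(1)] Y(2) by blast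
      then show "v \<in> S X" using Y by simp
    qed
    have "D.sccs_verts = S ` Q"
      unfolding D.sccs_verts_conv_scc_of
    proof (intro set_eqI iffI)
      fix Z assume "Z \<in> D.scc_of ` verts (G \<restriction> D)"
      then obtain u where u: "u \<in> D" "Z = D.scc_of u" by auto
      then obtain X where "X \<in> Q" "u \<in> S X" by (auto simp: D_def)
      then show "Z \<in> S ` Q" using scc u by blast
    next
      fix Z assume "Z \<in> S ` Q"
      then obtain X where X: "X \<in> Q" "Z = S X" by blast
      then obtain u where u: "u \<in> S X" using S(2) by blast
      then have "u \<in> verts (G \<restriction> D)" "Z = D.scc_of u" using scc[OF X(1) u] X by (auto simp: D_def)
      then show "Z \<in> D.scc_of ` verts (G \<restriction> D)" by blast
    qed
    moreover have "inj_on S Q"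
    proof (rule inj_onI)
      fix X Y assume XY: "X \<in> Q" "Y \<in> Q" "S X = S Y"
      obtain u where "u \<in> S X" using S(2) XY by blast
      then show "X = Y" using disj[OF XY(1,2)] S(1)[OF XY(1)] S(1)[OF XY(2)] XY(3) by blast
    qed
    ultimately have "card D.sccs = card Q"
      unfolding D.card_sccs_verts[symmetric] by (simp add: card_image)
    moreover have "Q = verts ` {K \<in> sccs. arcs K \<noteq> {}}"
    proof -
      have "(\<exists>u\<in>verts K. \<exists>v\<in>verts K. u \<rightarrow>\<^bsub>G\<^esub> v) \<longleftrightarrow> arcs K \<noteq> {}" if "K \<in> sccs" for K
      proof -
        have ind: "induced_subgraph K G" using that by (rule in_sccs_imp_induced)
        interpret K: wf_digraph K using ind by (rule wf_digraphI_induced)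
        have "(\<exists>u\<in>verts K. \<exists>v\<in>verts K. u \<rightarrow>\<^bsub>G\<^esub> v) \<longleftrightarrow> (\<exists>u v. u \<rightarrow>\<^bsub>K\<^esub> v)"
          unfolding dominates_induced[OF ind] by blast
        also have "\<dots> \<longleftrightarrow> arcs K \<noteq> {}" unfolding arcs_ends_conv by auto
        finally show ?thesis .
      qed
      then show ?thesis unfolding Q_def sccs_verts_conv by blast
    qed
    moreover have "inj_on verts {K \<in> sccs. arcs K \<noteq> {}}"
      using inj_on_verts_sccs by (rule inj_on_subset) auto
    ultimately show ?thesis by (simp add: card_image)
  qed
  ultimately have "connected_vertex_cover G D" by (simp add: connected_vertex_cover_def)
  then have "cvc_number G \<le> card D" unfolding cvc_number_def by (intro Least_le) blast
  moreover have "2 * card D \<le> 3 * card C"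
  proof -
    have "card D \<le> (\<Sum>X\<in>Q. card (S X))" unfolding D_def using fQ by (rule card_UN_le)
    then have "2 * card D \<le> (\<Sum>X\<in>Q. 2 * card (S X))" by (simp add: sum_distrib_left[symmetric])
    also have "\<dots> \<le> (\<Sum>X\<in>Q. 3 * card (C \<inter> X))" using S(3) by (intro sum_mono) blast
    also have "\<dots> = 3 * (\<Sum>X\<in>Q. card (C \<inter> X))" by (simp add: sum_distrib_left)
    also have "(\<Sum>X\<in>Q. card (C \<inter> X)) = card (\<Union>X\<in>Q. C \<inter> X)"
      using fQ fC disj by (intro card_UN_disjoint[symmetric]) blast+
    also have "\<dots> \<le> card C" using fC by (intro card_mono) auto
    finally show ?thesis by simp
  qed
  ultimately show ?thesis using C(2) by linarith
qed

theorem theorem4: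
  fixes G :: "('a, 'b) pre_digraph"
  assumes "graph G"
  shows "(\<forall>H. induced_subgraph H G \<longrightarrow> real (cvc_number H) \<le> 3 / 2 * real (vc_number H)) \<longleftrightarrow>
     \<not> contains_induced G (with_proj (path_graph 7)) \<and>
     \<not> contains_induced G (with_proj (cycle_graph 6)) \<and>
     \<not> contains_induced G (with_proj Delta1) \<and>
     \<not> contains_induced G (with_proj Delta2)"
  unfolding not_contains_patterns_iff[OF assms]
proof (intro iffI allI impI)
  fix f
  assume ratio: "\<forall>H. induced_subgraph H G \<longrightarrow> real (cvc_number H) \<le> 3 / 2 * real (vc_number H)"
  \<comment> \<open>The covers of size 3 are alternate vertices of the path and of the cycle, and
    for \<open>Delta1\<close> and \<open>Delta2\<close> the vertex c with \<open>a2\<close> and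
    \<open>b2\<close>.\<close>
  have "\<not> embeds G 7 P7_edges f"
    using embeds_bad_ratio[OF assms, of 7 P7_edges f "{1,3,5}"] ratio linked_patterns P7_lower
    by (auto simp: covers_def)
  moreover have "\<not> embeds G 6 C6_edges f"
    using embeds_bad_ratio[OF assms, of 6 C6_edges f "{0,2,4}"] ratio linked_patterns C6_lower
    by (auto simp: covers_def)
  moreover have "\<not> embeds G 7 D1_edges f"
    using embeds_bad_ratio[OF assms, of 7 D1_edges f "{0,2,5}"] ratio linked_patterns D1_lower
    by (auto simp: covers_def)
  moreover have "\<not> embeds G 7 D2_edges f"
    using embeds_bad_ratio[OF assms, of 7 D2_edges f "{0,2,5}"] ratio linked_patterns D2_lower
    by (auto simp: covers_def)
  ultimately show "\<not> embeds G 7 P7_edges f \<and> \<not> embeds G 6 C6_edges f \<and>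
        \<not> embeds G 7 D1_edges f \<and> \<not> embeds G 7 D2_edges f" by blast
next
  fix H
  assume free: "\<forall>f. \<not> embeds G 7 P7_edges f \<and> \<not> embeds G 6 C6_edges f \<and>
        \<not> embeds G 7 D1_edges f \<and> \<not> embeds G 7 D2_edges f" and H: "induced_subgraph H G"
  have "2 * cvc_number H \<le> 3 * vc_number H"
    using cvc_number_le[OF graph_induced_subgraph[OF assms H]] free embeds_induced[OF H] by blast
  then show "real (cvc_number H) \<le> 3 / 2 * real (vc_number H)" by linarith
qed

end
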